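(* (In $\mathrm{BST}$.) Let $(\Omega,\mathcal{A},\mu)$ be an internal finitely-additive measure space with $\Omega\subseteq O$ for a standard set $O$, let $I$ be a standard set, and let $w\in I$ be good and such that $\Omega,\mathcal{A},\mu$ are $w$-standard. Let $([\Omega],\mathcal{B},m)$ be the standard finitely additive measure space constructed from these data as in the context. If $\langle A_k\mid k\in\mathbb{N}\rangle$ is a sequence of mutually disjoint sets in $\mathcal{B}$, $A\in\mathcal{B}$, and $A=\bigcup_{k\in\mathbb{N}}A_k$, then $m(A)=\sum_{k\in\mathbb{N}}m(A_k)$.
   Context: **Theory $\mathrm{BST}$ (Bounded Set Theory).** Language: $\in$ and a unary predicate $\mathrm{st}$ ("is standard"). Quantifiers $\forall^{\mathrm{st}},\exists^{\mathrm{st}}$ range over standard sets, $\forall^{\mathrm{st\,fin}}$ over standard finite sets. An $\in$-formula is one not mentioning $\mathrm{st}$. All sets of $\mathrm{BST}$ are called internal. Axioms: - all axioms of $\mathrm{ZFC}$ (Separation and Replacement only for $\in$-formulas); - Boundedness: $\forall x\,\exists^{\mathrm{st}}y\,(x\in y)$; - Transfer: $\forall^{\mathrm{st}}x\,\phi(x)\rightarrow\forall x\,\phi(x)$ for $\in$-formulas $\phi$ with standard parameters; - Standardization: $\forall A\,\exists^{\mathrm{st}}S\,\forall^{\mathrm{st}}x\,(x\in S\leftrightarrow x\in A\wedge\phi(x))$ for any $\mathrm{st}$-$\in$-formula $\phi$ with arbitrary parameters; - Bounded Idealization: for every standard $A$ and every $\in$-formula $\phi$ with arbitrary parameters, $\forall^{\mathrm{st\,fin}}a\subseteq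 A\,\exists y\,\forall x\in a\,\phi(x,y)\leftrightarrow\exists y\,\forall^{\mathrm{st}}x\in A\,\phi(x,y)$. **Notation.** For standard $A$ and any $\mathrm{st}$-$\in$-formula $\phi$, ${}^{\mathrm{st}}\{x\in A\mid\phi(x)\}$ is the unique standard set $S$ with $\forall^{\mathrm{st}}x\,(x\in S\leftrightarrow x\in A\wedge\phi(x))$. A real is limited if its absolute value is $<n$ for some standard $n\in\mathbb{N}$; for limited $r$, $\mathrm{sh}(r)$ is the unique standard real infinitely close to $r$ (i.e. $|r-\mathrm{sh}(r)|<1/n$ for all standard $n\ge1$); $\mathrm{sh}(r)=+\infty$ if $r>0$ is unlimited (or $r=+\infty$). **$w$-standard sets.** For $w\in I$, $I$ standard, $x$ is $w$-standard if $x=f(w)$ for some standard function $f$ with domain $I$; $\mathbf{S}_w$ is the class of $w$-standard sets. The set $w$ is good if there is $\nu\in\mathbb{N}$ which is $w$-standard but not standard. **Construction.** $(\Omega,\mathcal{A},\mu)$ internal finitely-additive measure space: $\mathcal{A}$ is an algebra of subsets of $\Omega$ and $\mu$ is a finitely additive nonnegative measure on $\mathcal{A}$. For standard $f\in O^I$ let $f_w={}^{\mathrm{st}}\{g\in O^I\mid g(w)=f(w)\}$, and let $O^I/w={}^{\mathrm{st}}\{f_w\mid f\in O^I \text{ standard}\}$ (the standard set whose standard elements are exactly the $f_w$ for standard $f\in O^I$). For $X\in\mathcal{A}\cap\mathbf{S}_w$ let $[X]={}^{\mathrm{st}}\{f_w\mid f\in O^I\wedge f(w)\in X\cap\mathbf{S}_w\}$,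 i.e. the standard subset of $O^I/w$ whose standard elements are the $f_w$ with $f\in O^I$ standard and $f(w)\in X$; $[\Omega]$ is defined likewise. Let $\mathcal{B}={}^{\mathrm{st}}\{A\in\mathcal{P}(O^I/w)\mid A=[X]\text{ for some }X\in\mathcal{A}\cap\mathbf{S}_w\}$; this is a standard algebra of subsets of $[\Omega]$, and for standard $A\in\mathcal{B}$ the set $X\in\mathcal{A}\cap\mathbf{S}_w$ with $A=[X]$ is unique. Let $m:\mathcal{B}\to[0,+\infty]$ be the unique standard function such that $m(A)=\mathrm{sh}(\mu(X))$ for standard $A=[X]\in\mathcal{B}$; it is a finitely additive measure. *)

theory Defs
  imports Main
begin

text \<open>
  Bounded set theory is a first-order theory in the language with a binary relation (membership)
  and a unary predicate (``is standard''). We work in an arbitrary model of it: a HOL type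
  \<open>'u\<close> of internal sets carrying these two relations. All axiom schemata range over
  first-order formulas, so formulas are deeply embedded.
\<close>

record 'u set_structure =
  mem :: "'u \<Rightarrow> 'u \<Rightarrow> bool" (infix "\<epsilon>\<index>" 50)
  st :: "'u \<Rightarrow> bool"


section \<open>Formulas and satisfaction\<close>

text \<open>Variables are de Bruijn indices; index 0 is bound by the innermost quantifier.\<close>

datatype fm =
    FMem nat nat
  | FEq nat nat
  | FSt nat
  | FNeg fm
  | FConj fm fm
  | FAll fm

primrec in_formula :: "fm \<Rightarrow> bool" where
  "in_formula (FMem i j) = True"
| "in_formula (FEq i j) = True"
| "in_formula (FSt i) = False"
| "in_formula (FNeg \<phi>) = in_formula \<phi>"
| "in_formula (FConj \<phi> \<psi>) = (in_formula \<phi> \<and> in_formula \<psi>)"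
| "in_formula (FAll \<phi>) = in_formula \<phi>"

definition env_cons :: "'u \<Rightarrow> (nat \<Rightarrow> 'u) \<Rightarrow> nat \<Rightarrow> 'u" (infixr "##" 65) where
  "x ## e = case_nat x e"

primrec sat :: "'u set_structure \<Rightarrow> (nat \<Rightarrow> 'u) \<Rightarrow> fm \<Rightarrow> bool" where
  "sat M e (FMem i j) = (e i \<epsilon>\<^bsub>M\<^esub> e j)"
| "sat M e (FEq i j) = (e i = e j)"
| "sat M e (FSt i) = st M (e i)"
| "sat M e (FNeg \<phi>) = (\<not> sat M e \<phi>)"
| "sat M e (FConj \<phi> \<psi>) = (sat M e \<phi> \<and> sat M e \<psi>)"
| "sat M e (FAll \<phi>) = (\<forall>x. sat M (x ## e) \<phi>)"


section \<open>Set-theoretic notions inside a structure\<close>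

context
  fixes M :: "'u set_structure" (structure)
begin

definition subs :: "'u \<Rightarrow> 'u \<Rightarrow> bool" where
  "subs x y \<longleftrightarrow> (\<forall>t. t \<epsilon> x \<longrightarrow> t \<epsilon> y)"

definition disjoint :: "'u \<Rightarrow> 'u \<Rightarrow> bool" where
  "disjoint x y \<longleftrightarrow> \<not> (\<exists>t. t \<epsilon> x \<and> t \<epsilon> y)"

text \<open>
  \<open>setof M P\<close> is the internal set \<open>{t | P t}\<close>. It is meaningful only where the model has such a
  set; this is a theorem of ZFC at every use below.
\<close>

definition setof :: "('u \<Rightarrow> bool) \<Rightarrow> 'u" where
  "setof P = (THE z. \<forall>t. t \<epsilon> z \<longleftrightarrow> P t)"

definition emp :: 'u where
  "emp = setof (\<lambda>t. False)"

definition union :: "'u \<Rightarrow> 'u \<Rightarrow> 'u" where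
  "union x y = setof (\<lambda>t. t \<epsilon> x \<or> t \<epsilon> y)"

definition sdiff :: "'u \<Rightarrow> 'u \<Rightarrow> 'u" where
  "sdiff x y = setof (\<lambda>t. t \<epsilon> x \<and> \<not> t \<epsilon> y)"

definition powset :: "'u \<Rightarrow> 'u" where
  "powset x = setof (\<lambda>t. subs t x)"

definition upair :: "'u \<Rightarrow> 'u \<Rightarrow> 'u" where
  "upair x y = setof (\<lambda>t. t = x \<or> t = y)"

definition opair :: "'u \<Rightarrow> 'u \<Rightarrow> 'u" where
  "opair x y = upair (upair x x) (upair x y)"

definition cartprod :: "'u \<Rightarrow> 'u \<Rightarrow> 'u" where
  "cartprod A B = setof (\<lambda>t. \<exists>x y. x \<epsilon> A \<and> y \<epsilon> B \<and> t = opair x y)"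

definition func_on :: "'u \<Rightarrow> 'u \<Rightarrow> bool" where
  "func_on f D \<longleftrightarrow>
     (\<forall>t. t \<epsilon> f \<longrightarrow> (\<exists>x y. x \<epsilon> D \<and> t = opair x y)) \<and>
     (\<forall>x. x \<epsilon> D \<longrightarrow> (\<exists>!y. opair x y \<epsilon> f))"

definition app :: "'u \<Rightarrow> 'u \<Rightarrow> 'u" where
  "app f x = (THE y. opair x y \<epsilon> f)"

definition maps :: "'u \<Rightarrow> 'u \<Rightarrow> 'u \<Rightarrow> bool" where
  "maps f D C \<longleftrightarrow> func_on f D \<and> (\<forall>x. x \<epsilon> D \<longrightarrow> app f x \<epsilon> C)"

definition funspace :: "'u \<Rightarrow> 'u \<Rightarrow> 'u" where
  "funspace D C = setof (\<lambda>f. maps f D C)"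

text \<open>Von Neumann natural numbers and internal finiteness.\<close>

definition vnsuc :: "'u \<Rightarrow> 'u" where
  "vnsuc x = setof (\<lambda>t. t \<epsilon> x \<or> t = x)"

definition vnat :: "'u \<Rightarrow> bool" where
  "vnat n \<longleftrightarrow> (\<forall>J. emp \<epsilon> J \<and> (\<forall>x. x \<epsilon> J \<longrightarrow> vnsuc x \<epsilon> J) \<longrightarrow> n \<epsilon> J)"

definition fin :: "'u \<Rightarrow> bool" where
  "fin a \<longleftrightarrow> (\<exists>n f. vnat n \<and> maps f n a \<and> (\<forall>y. y \<epsilon> a \<longrightarrow> (\<exists>!x. x \<epsilon> n \<and> app f x = y)))"

end


section \<open>The axioms\<close>

locale ZFC_model =
  fixes M :: "'u set_structure" (structure)
  assumes extensionality: "(\<forall>t. t \<epsilon> x \<longleftrightarrow> t \<epsilon> y) \<Longrightarrow> x = y"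
    and foundation: "\<exists>y. y \<epsilon> x \<Longrightarrow> \<exists>y. y \<epsilon> x \<and> \<not> (\<exists>z. z \<epsilon> x \<and> z \<epsilon> y)"
    and pairing: "\<exists>z. \<forall>t. t \<epsilon> z \<longleftrightarrow> t = x \<or> t = y"
    and Union: "\<exists>z. \<forall>t. t \<epsilon> z \<longleftrightarrow> (\<exists>y. y \<epsilon> x \<and> t \<epsilon> y)"
    and powerset: "\<exists>z. \<forall>t. t \<epsilon> z \<longleftrightarrow> (\<forall>s. s \<epsilon> t \<longrightarrow> s \<epsilon> x)"
    and infinity: "\<exists>J. (\<exists>z. z \<epsilon> J \<and> (\<forall>t. \<not> t \<epsilon> z)) \<and>
      (\<forall>x. x \<epsilon> J \<longrightarrow> (\<exists>y. y \<epsilon> J \<and> (\<forall>t. t \<epsilon> y \<longleftrightarrow> t \<epsilon> x \<or> t = x)))"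
    and choice: "(\<forall>x. x \<epsilon> F \<longrightarrow> (\<exists>t. t \<epsilon> x)) \<Longrightarrow>
      (\<forall>x y. x \<epsilon> F \<and> y \<epsilon> F \<and> x \<noteq> y \<longrightarrow> \<not> (\<exists>t. t \<epsilon> x \<and> t \<epsilon> y)) \<Longrightarrow>
      \<exists>C. \<forall>x. x \<epsilon> F \<longrightarrow> (\<exists>!t. t \<epsilon> x \<and> t \<epsilon> C)"
    and separation: "in_formula \<phi> \<Longrightarrow> \<exists>B. \<forall>x. x \<epsilon> B \<longleftrightarrow> x \<epsilon> A \<and> sat M (x ## e) \<phi>"
    and replacement: "in_formula \<phi> \<Longrightarrow>
      (\<forall>x y y'. x \<epsilon> A \<and> sat M (x ## y ## e) \<phi> \<and> sat M (x ## y' ## e) \<phi> \<longrightarrow> y = y') \<Longrightarrow>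
      \<exists>B. \<forall>y. y \<epsilon> B \<longleftrightarrow> (\<exists>x. x \<epsilon> A \<and> sat M (x ## y ## e) \<phi>)"

locale BST_model = ZFC_model +
  assumes boundedness: "\<exists>y. st M y \<and> x \<epsilon> y"
    and transfer: "in_formula \<phi> \<Longrightarrow> (\<forall>i. st M (e i)) \<Longrightarrow>
      (\<forall>x. st M x \<longrightarrow> sat M (x ## e) \<phi>) \<Longrightarrow> sat M (x ## e) \<phi>"
    and standardization:
      "\<exists>S. st M S \<and> (\<forall>x. st M x \<longrightarrow> (x \<epsilon> S \<longleftrightarrow> x \<epsilon> A \<and> sat M (x ## e) \<phi>))"
    and bounded_idealization: "st M A \<Longrightarrow> in_formula \<phi> \<Longrightarrow>
      (\<forall>a. st M a \<and> fin M a \<and> subs M a A \<longrightarrow> (\<exists>y. \<forall>x. x \<epsilon> a \<longrightarrow> sat M (x ## y ## e) \<phi>)) \<longleftrightarrow>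
      (\<exists>y. \<forall>x. st M x \<and> x \<epsilon> A \<longrightarrow> sat M (x ## y ## e) \<phi>)"


section \<open>Real numbers inside a model\<close>

text \<open>
  The internal reals are given as an arbitrary internal Dedekind-complete ordered field together
  with an object \<open>rinf\<close> outside of it that plays the role of \<open>+\<infinity>\<close>. All components are
  internal sets, and completeness refers to internal sets of reals.
\<close>

record 'u real_structure =
  rcar :: 'u
  radd :: 'u
  rmul :: 'u
  rzero :: 'u
  rone :: 'u
  rlt :: 'u
  rinf :: 'u

context
  fixes M :: "'u set_structure" (structure) and R :: "'u real_structure"
begin

definition is_real :: "'u \<Rightarrow> bool" where
  "is_real x \<longleftrightarrow> x \<epsilon> rcar R"

definition plus_r :: "'u \<Rightarrow> 'u \<Rightarrow> 'u" where
  "plus_r x y = app M (radd R) (opair M x y)"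

definition times_r :: "'u \<Rightarrow> 'u \<Rightarrow> 'u" where
  "times_r x y = app M (rmul R) (opair M x y)"

definition less_r :: "'u \<Rightarrow> 'u \<Rightarrow> bool" where
  "less_r x y \<longleftrightarrow> opair M x y \<epsilon> rlt R"

definition le_r :: "'u \<Rightarrow> 'u \<Rightarrow> bool" where
  "le_r x y \<longleftrightarrow> less_r x y \<or> x = y"

definition complete_ordered_field :: bool where
  "complete_ordered_field \<longleftrightarrow>
     maps M (radd R) (cartprod M (rcar R) (rcar R)) (rcar R) \<and>
     maps M (rmul R) (cartprod M (rcar R) (rcar R)) (rcar R) \<and>
     subs M (rlt R) (cartprod M (rcar R) (rcar R)) \<and>
     is_real (rzero R) \<and> is_real (rone R) \<and> rzero R \<noteq> rone R \<and>
     (\<forall>x y z. is_real x \<and> is_real y \<and> is_real z \<longrightarrow>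
        plus_r (plus_r x y) z = plus_r x (plus_r y z) \<and>
        plus_r x y = plus_r y x \<and>
        times_r (times_r x y) z = times_r x (times_r y z) \<and>
        times_r x y = times_r y x \<and>
        times_r x (plus_r y z) = plus_r (times_r x y) (times_r x z) \<and>
        (less_r x y \<and> less_r y z \<longrightarrow> less_r x z) \<and>
        (less_r x y \<longrightarrow> less_r (plus_r x z) (plus_r y z)) \<and>
        (less_r x y \<and> less_r (rzero R) z \<longrightarrow> less_r (times_r x z) (times_r y z))) \<and>
     (\<forall>x. is_real x \<longrightarrow>
        plus_r (rzero R) x = x \<and> times_r (rone R) x = x \<and> \<not> less_r x x \<and>
        (\<exists>y. is_real y \<and> plus_r x y = rzero R) \<and>
        (x \<noteq> rzero R \<longrightarrow> (\<exists>y. is_real y \<and> times_r x y = rone R))) \<and>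
     (\<forall>x y. is_real x \<and> is_real y \<longrightarrow> less_r x y \<or> x = y \<or> less_r y x) \<and>
     (\<forall>C. subs M C (rcar R) \<and> (\<exists>x. x \<epsilon> C) \<and>
          (\<exists>b. is_real b \<and> (\<forall>x. x \<epsilon> C \<longrightarrow> le_r x b)) \<longrightarrow>
        (\<exists>s. is_real s \<and> (\<forall>x. x \<epsilon> C \<longrightarrow> le_r x s) \<and>
             (\<forall>b. is_real b \<and> (\<forall>x. x \<epsilon> C \<longrightarrow> le_r x b) \<longrightarrow> le_r s b)))"

text \<open>
  The real line of a model is defined by a parameter-free \<open>\<in>\<close>-formula, hence is standard.
\<close>

definition standard_reals :: bool where
  "standard_reals \<longleftrightarrow> complete_ordered_field \<and> \<not> is_real (rinf R) \<and>
     st M (rcar R) \<and> st M (radd R) \<and> st M (rmul R) \<and> st M (rzero R) \<and> st M (rone R) \<and>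
     st M (rlt R) \<and> st M (rinf R)"

definition uminus_r :: "'u \<Rightarrow> 'u" where
  "uminus_r x = (THE y. is_real y \<and> plus_r x y = rzero R)"

definition inverse_r :: "'u \<Rightarrow> 'u" where
  "inverse_r x = (THE y. is_real y \<and> times_r x y = rone R)"

definition abs_r :: "'u \<Rightarrow> 'u" where
  "abs_r x = (if less_r x (rzero R) then uminus_r x else x)"

text \<open>The natural numbers are regarded as a set of reals: the least inductive one.\<close>

definition nats :: 'u where
  "nats = setof M (\<lambda>n. is_real n \<and>
     (\<forall>J. subs M J (rcar R) \<and> rzero R \<epsilon> J \<and> (\<forall>x. x \<epsilon> J \<longrightarrow> plus_r x (rone R) \<epsilon> J) \<longrightarrow> n \<epsilon> J))"

text \<open>The extended half-line \<open>[0,+\<infinity>]\<close>, its addition and its strict order.\<close>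

definition ext_nonneg :: 'u where
  "ext_nonneg = setof M (\<lambda>x. is_real x \<and> le_r (rzero R) x \<or> x = rinf R)"

definition plus_x :: "'u \<Rightarrow> 'u \<Rightarrow> 'u" where
  "plus_x a b = (if is_real a \<and> is_real b then plus_r a b else rinf R)"

definition less_x :: "'u \<Rightarrow> 'u \<Rightarrow> bool" where
  "less_x a b \<longleftrightarrow> is_real a \<and> (is_real b \<and> less_r a b \<or> b = rinf R)"

text \<open>Convergence of an internal sequence in the order topology of \<open>[0,+\<infinity>]\<close>.\<close>

definition tends_x :: "'u \<Rightarrow> 'u \<Rightarrow> bool" where
  "tends_x p l \<longleftrightarrow> l \<epsilon> ext_nonneg \<and>
     (\<forall>a. a \<epsilon> ext_nonneg \<and> less_x a l \<longrightarrow>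
        (\<exists>N. N \<epsilon> nats \<and> (\<forall>n. n \<epsilon> nats \<and> le_r N n \<longrightarrow> less_x a (app M p n)))) \<and>
     (\<forall>b. b \<epsilon> ext_nonneg \<and> less_x l b \<longrightarrow>
        (\<exists>N. N \<epsilon> nats \<and> (\<forall>n. n \<epsilon> nats \<and> le_r N n \<longrightarrow> less_x (app M p n) b)))"

text \<open>
  \<open>sums_x M R a l\<close>: the series \<open>\<Sum>k\<in>\<nat>. a k\<close> of elements of \<open>[0,+\<infinity>]\<close> has sum \<open>l\<close>. The
  sequence \<open>p\<close> of partial sums is an internal function on all of the (internal) naturals.
\<close>

definition sums_x :: "('u \<Rightarrow> 'u) \<Rightarrow> 'u \<Rightarrow> bool" where
  "sums_x a l \<longleftrightarrow> (\<exists>p. maps M p nats ext_nonneg \<and>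
     app M p (rzero R) = rzero R \<and>
     (\<forall>k. k \<epsilon> nats \<longrightarrow> app M p (plus_r k (rone R)) = plus_x (app M p k) (a k)) \<and>
     tends_x p l)"

definition limited :: "'u \<Rightarrow> bool" where
  "limited r \<longleftrightarrow> is_real r \<and> (\<exists>n. st M n \<and> n \<epsilon> nats \<and> less_r (abs_r r) n)"

text \<open>
  The shadow is used for arguments in \<open>[0,+\<infinity>]\<close> only, where not being limited means being
  positive unlimited or \<open>+\<infinity>\<close>.
\<close>

definition sh :: "'u \<Rightarrow> 'u" where
  "sh r = (if limited r
     then (THE s. st M s \<and> is_real s \<and>
             (\<forall>n. st M n \<and> n \<epsilon> nats \<and> le_r (rone R) n \<longrightarrow>
                  less_r (abs_r (plus_r r (uminus_r s))) (inverse_r n)))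
     else rinf R)"

definition algebra_of_sets :: "'u \<Rightarrow> 'u \<Rightarrow> bool" where
  "algebra_of_sets \<Omega> \<A> \<longleftrightarrow>
     (\<forall>X. X \<epsilon> \<A> \<longrightarrow> subs M X \<Omega>) \<and> \<Omega> \<epsilon> \<A> \<and>
     (\<forall>X. X \<epsilon> \<A> \<longrightarrow> sdiff M \<Omega> X \<epsilon> \<A>) \<and>
     (\<forall>X Y. X \<epsilon> \<A> \<and> Y \<epsilon> \<A> \<longrightarrow> union M X Y \<epsilon> \<A>)"

definition fin_add_measure_space :: "'u \<Rightarrow> 'u \<Rightarrow> 'u \<Rightarrow> bool" where
  "fin_add_measure_space \<Omega> \<A> \<mu> \<longleftrightarrow>
     algebra_of_sets \<Omega> \<A> \<and> maps M \<mu> \<A> ext_nonneg \<and> app M \<mu> (emp M) = rzero R \<and>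
     (\<forall>X Y. X \<epsilon> \<A> \<and> Y \<epsilon> \<A> \<and> disjoint M X Y \<longrightarrow>
        app M \<mu> (union M X Y) = plus_x (app M \<mu> X) (app M \<mu> Y))"

end


section \<open>The construction\<close>

context
  fixes M :: "'u set_structure" (structure)
begin

text \<open>
  \<open>st_set M A P\<close> is the unique standard \<open>S\<close> with the same standard elements as
  \<open>{x \<in> A | P x}\<close>. It is meaningful when \<open>A\<close> is standard and \<open>P\<close> is defined by a formula
  of the language with membership and standardness (parameters allowed), as at every use below.
\<close>

definition st_set :: "'u \<Rightarrow> ('u \<Rightarrow> bool) \<Rightarrow> 'u" where
  "st_set A P = (THE S. st M S \<and> (\<forall>x. st M x \<longrightarrow> (x \<epsilon> S \<longleftrightarrow> x \<epsilon> A \<and> P x)))"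

definition w_standard :: "'u \<Rightarrow> 'u \<Rightarrow> 'u \<Rightarrow> bool" where
  "w_standard I w x \<longleftrightarrow> (\<exists>f. st M f \<and> func_on M f I \<and> x = app M f w)"

definition good :: "'u real_structure \<Rightarrow> 'u \<Rightarrow> 'u \<Rightarrow> bool" where
  "good R I w \<longleftrightarrow> (\<exists>\<nu>. \<nu> \<epsilon> nats M R \<and> w_standard I w \<nu> \<and> \<not> st M \<nu>)"

text \<open>
  In what follows \<open>Os\<close> is the standard set called \<open>O\<close> in the informal description
  (the letter is a library infix). \<open>germ\<close> is \<open>f\<^sub>w\<close>, \<open>quot\<close> is \<open>O\<^sup>I/w\<close>, \<open>brack\<close> is
  \<open>[X]\<close> (so \<open>[\<Omega>]\<close> is \<open>brack M I Os w \<Omega>\<close>) and \<open>loeb_algebra\<close> is the algebra \<open>\<B>\<close>.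
\<close>

definition germ :: "'u \<Rightarrow> 'u \<Rightarrow> 'u \<Rightarrow> 'u \<Rightarrow> 'u" where
  "germ I Os w f = st_set (funspace M I Os) (\<lambda>g. app M g w = app M f w)"

definition quot :: "'u \<Rightarrow> 'u \<Rightarrow> 'u \<Rightarrow> 'u" where
  "quot I Os w = st_set (powset M (funspace M I Os))
     (\<lambda>c. \<exists>f. st M f \<and> f \<epsilon> funspace M I Os \<and> c = germ I Os w f)"

definition brack :: "'u \<Rightarrow> 'u \<Rightarrow> 'u \<Rightarrow> 'u \<Rightarrow> 'u" where
  "brack I Os w X = st_set (quot I Os w)
     (\<lambda>c. \<exists>f. st M f \<and> f \<epsilon> funspace M I Os \<and> app M f w \<epsilon> X \<and> c = germ I Os w f)"

definition loeb_algebra :: "'u \<Rightarrow> 'u \<Rightarrow> 'u \<Rightarrow> 'u \<Rightarrow> 'u" where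
  "loeb_algebra I Os w \<A> = st_set (powset M (quot I Os w))
     (\<lambda>A. \<exists>X. X \<epsilon> \<A> \<and> w_standard I w X \<and> A = brack I Os w X)"

text \<open>
  The measure is pinned down as a standard function on \<open>\<B>\<close> by its values at the
  standard elements of \<open>\<B>\<close>.
\<close>

definition is_loeb_measure ::
    "'u real_structure \<Rightarrow> 'u \<Rightarrow> 'u \<Rightarrow> 'u \<Rightarrow> 'u \<Rightarrow> 'u \<Rightarrow> 'u \<Rightarrow> bool" where
  "is_loeb_measure R I Os w \<A> \<mu> m \<longleftrightarrow>
     st M m \<and> maps M m (loeb_algebra I Os w \<A>) (ext_nonneg M R) \<and>
     (\<forall>A X. st M A \<and> A \<epsilon> loeb_algebra I Os w \<A> \<and>
            X \<epsilon> \<A> \<and> w_standard I w X \<and> A = brack I Os w X \<longrightarrow>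
        app M m A = sh M R (app M \<mu> X))"

end

end

theory Submission
  imports Defs
begin

text \<open>
  The point is that \<open>\<B>\<close> satisfies a compactness property: if \<open>A = \<Union>k. A\<^sub>k\<close> in \<open>\<B>\<close>, then
  \<open>A\<close> is already a finite partial union, so the partial sums of \<open>\<Sum>k. m (A\<^sub>k)\<close> are eventually equal
  to \<open>m A\<close> and finite additivity suffices. By transfer, \<open>A = [F w]\<close> and the sequence may be taken to be
  standard, and there is a standard sequence \<open>G\<close> with \<open>A\<^sub>k = [G\<^sub>k w]\<close> for standard \<open>k\<close>. If no standard
  \<open>n\<close> works, then \<open>D n = F w - (\<Union>k<n. G\<^sub>k w)\<close> is nonempty for all standard \<open>n\<close>. As \<open>w\<close> is good, some
  unlimited natural number is \<open>h w\<close> with \<open>h\<close> standard. Choosing, uniformly in \<open>v \<in> I\<close>, an element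
  \<open>g v\<close> of the last nonempty \<open>F v - (\<Union>k<n. G\<^sub>k v)\<close> with \<open>n \<le> h v\<close> yields a standard \<open>g\<close> such that
  \<open>g w\<close> lies in \<open>D n\<close> for all standard \<open>n\<close>; its germ is a standard element of \<open>A\<close> that belongs to no
  \<open>A\<^sub>k\<close> with \<open>k\<close> standard, which contradicts \<open>A = \<Union>k. A\<^sub>k\<close> by transfer.
\<close>

section \<open>Definability\<close>

text \<open>Renaming is what moves two formulas with separate parameter lists onto one common
  environment.\<close>

primrec ren :: "(nat \<Rightarrow> nat) \<Rightarrow> fm \<Rightarrow> fm" where
  "ren r (FMem i j) = FMem (r i) (r j)"
| "ren r (FEq i j) = FEq (r i) (r j)"
| "ren r (FSt i) = FSt (r i)"
| "ren r (FNeg \<phi>) = FNeg (ren r \<phi>)"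
| "ren r (FConj \<phi> \<psi>) = FConj (ren r \<phi>) (ren r \<psi>)"
| "ren r (FAll \<phi>) = FAll (ren (case_nat 0 (\<lambda>n. Suc (r n))) \<phi>)"

lemma in_formula_ren [simp]: "in_formula (ren r \<phi>) = in_formula \<phi>"
  by (induction \<phi> arbitrary: r) auto

lemma env_cons_simps [simp]: "(x ## e) 0 = x" "(x ## e) (Suc n) = e n"
  by (simp_all add: env_cons_def)

lemma env_cons_ren: "(\<lambda>i. (x ## e) (case_nat 0 (\<lambda>n. Suc (r n)) i)) = x ## (\<lambda>i. e (r i))"
  by (rule ext) (simp add: env_cons_def split: nat.split)

lemma sat_ren [simp]: "sat M e (ren r \<phi>) = sat M (\<lambda>i. e (r i)) \<phi>"
  by (induction \<phi> arbitrary: r e) (simp_all add: env_cons_ren)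

text \<open>Arguments sit at even and parameters at odd positions, so neither list needs a bound on
  its length.\<close>

definition mix :: "(nat \<Rightarrow> 'u) \<Rightarrow> (nat \<Rightarrow> 'u) \<Rightarrow> nat \<Rightarrow> 'u" where
  "mix e c n = (if even n then e (n div 2) else c (n div 2))"

text \<open>
  \<open>dfb M s b P\<close>: the predicate \<open>P\<close> on environments is defined by a formula with parameters,
  which must be standard if \<open>s\<close> holds; \<open>st\<close> may occur in the formula only if \<open>b\<close> holds.
  \<open>deft\<close> is the corresponding notion for functions on environments.
\<close>

definition dfb :: "'u set_structure \<Rightarrow> bool \<Rightarrow> bool \<Rightarrow> ((nat \<Rightarrow> 'u) \<Rightarrow> bool) \<Rightarrow> bool" where
  "dfb M s b P \<longleftrightarrow> (\<exists>\<phi> c. (b \<or> in_formula \<phi>) \<and> (s \<longrightarrow> (\<forall>i. st M (c i))) \<and>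
     (\<forall>e. P e \<longleftrightarrow> sat M (mix e c) \<phi>))"

definition deft :: "'u set_structure \<Rightarrow> bool \<Rightarrow> bool \<Rightarrow> ((nat \<Rightarrow> 'u) \<Rightarrow> 'u) \<Rightarrow> bool" where
  "deft M s b t \<longleftrightarrow> dfb M s b (\<lambda>e. e 0 = t (\<lambda>n. e (Suc n)))"

named_theorems dfb

lemma dfbI:
  assumes "b \<or> in_formula \<phi>" "s \<longrightarrow> (\<forall>i. st M (c i))" "\<And>e. P e \<longleftrightarrow> sat M (mix e c) \<phi>"
  shows "dfb M s b P"
  unfolding dfb_def using assms by blast

lemma dfb_cong: "dfb M s b P \<Longrightarrow> (\<And>e. P e \<longleftrightarrow> Q e) \<Longrightarrow> dfb M s b Q"
  by (simp add: dfb_def)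

lemma dfb_ren:
  assumes "dfb M s b P" shows "dfb M s b (\<lambda>e. P (\<lambda>n. e (r n)))"
proof -
  from assms obtain \<phi> c where *: "b \<or> in_formula \<phi>" "s \<longrightarrow> (\<forall>i. st M (c i))"
    "\<And>e. P e \<longleftrightarrow> sat M (mix e c) \<phi>" unfolding dfb_def by blast
  let ?r = "\<lambda>n. if even n then 2 * r (n div 2) else n"
  have "(\<lambda>i. mix e c (?r i)) = mix (\<lambda>n. e (r n)) c" for e
    by (rule ext) (simp add: mix_def)
  then show ?thesis
    using * by (intro dfbI[of b "ren ?r \<phi>" s M c]) simp_all
qed

section \<open>Closure of definability under connectives, quantifiers and substitution\<close>

lemma dfb_neg [dfb]:
  assumes "dfb M s b P" shows "dfb M s b (\<lambda>e. \<not> P e)"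
proof -
  from assms obtain \<phi> c where *: "b \<or> in_formula \<phi>" "s \<longrightarrow> (\<forall>i. st M (c i))"
    "\<And>e. P e \<longleftrightarrow> sat M (mix e c) \<phi>" unfolding dfb_def by blast
  then show ?thesis
    by (intro dfbI[of b "FNeg \<phi>" s M c]) simp_all
qed

lemma dfb_conj [dfb]:
  assumes "dfb M s b P" "dfb M s b Q" shows "dfb M s b (\<lambda>e. P e \<and> Q e)"
proof -
  from assms(1) obtain \<phi> c where *: "b \<or> in_formula \<phi>" "s \<longrightarrow> (\<forall>i. st M (c i))"
    "\<And>e. P e \<longleftrightarrow> sat M (mix e c) \<phi>" unfolding dfb_def by blast
  from assms(2) obtain \<psi> d where **: "b \<or> in_formula \<psi>" "s \<longrightarrow> (\<forall>i. st M (d i))"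
    "\<And>e. Q e \<longleftrightarrow> sat M (mix e d) \<psi>" unfolding dfb_def by blast
  \<comment> \<open>The two parameter lists are interleaved in turn: entry k of \<open>c\<close>
    becomes parameter 2k of \<open>mix c d\<close>, and entry k of \<open>d\<close> becomes
    parameter 2k+1. Argument positions stay fixed.\<close>
  let ?f = "\<lambda>n. if even n then n else Suc (2 * (2 * (n div 2)))"
  let ?g = "\<lambda>n. if even n then n else Suc (2 * (Suc (2 * (n div 2))))"
  have "(\<lambda>i. mix e (mix c d) (?f i)) = mix e c" "(\<lambda>i. mix e (mix c d) (?g i)) = mix e d" for e
    by (rule ext, auto simp: mix_def elim!: oddE)+
  moreover have "s \<longrightarrow> (\<forall>i. st M (mix c d i))"
    using * ** by (simp add: mix_def)
  ultimately show ?thesis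
    using * ** by (intro dfbI[of b "FConj (ren ?f \<phi>) (ren ?g \<psi>)" s M "mix c d"]) auto
qed

lemma dfb_all [dfb]:
  assumes "dfb M s b (\<lambda>e. P (e 0) (\<lambda>n. e (Suc n)))"
  shows "dfb M s b (\<lambda>e. \<forall>x. P x e)"
proof -
  from assms obtain \<phi> c where *: "b \<or> in_formula \<phi>" "s \<longrightarrow> (\<forall>i. st M (c i))"
    "\<And>e. P (e 0) (\<lambda>n. e (Suc n)) \<longleftrightarrow> sat M (mix e c) \<phi>" unfolding dfb_def by blast
  \<comment> \<open>In \<open>x ## mix e c\<close> the argument \<open>e j\<close> stands at
    position 2j+1 and the parameter \<open>c j\<close> at 2j+2, whereas \<open>\<phi>\<close>
    expects them at 2j+2 and 2j+1. Position 0 holds \<open>x\<close> in both.\<close>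
  let ?r = "\<lambda>n. if n = 0 then 0 else if even n then n - 1 else Suc n"
  have "(x ## mix e c) (?r i) = mix (x ## e) c i" for x e i
  proof (cases i)
    case (Suc j)
    show ?thesis
    proof (cases "even j")
      case True then show ?thesis using Suc by (auto simp: mix_def)
    next
      case False
      then obtain k where "j = 2 * k + 1" by (auto elim: oddE)
      then show ?thesis using Suc by (simp add: mix_def)
    qed
  qed (simp add: mix_def)
  then have "(\<lambda>i. (x ## mix e c) (?r i)) = mix (x ## e) c" for x e
    by (rule ext)
  moreover have "P x e \<longleftrightarrow> sat M (mix (x ## e) c) \<phi>" for x e
    using *(3)[of "x ## e"] by simp
  ultimately show ?thesis
    using * by (intro dfbI[of b "FAll (ren ?r \<phi>)" s M c]) simp_all
qed

lemma dfb_disj [dfb]: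
  assumes "dfb M s b P" "dfb M s b Q" shows "dfb M s b (\<lambda>e. P e \<or> Q e)"
  using dfb_neg[OF dfb_conj[OF dfb_neg[OF assms(1)] dfb_neg[OF assms(2)]]] by simp

lemma dfb_imp [dfb]:
  assumes "dfb M s b P" "dfb M s b Q" shows "dfb M s b (\<lambda>e. P e \<longrightarrow> Q e)"
  using dfb_neg[OF dfb_conj[OF assms(1) dfb_neg[OF assms(2)]]] by simp

lemma dfb_iff [dfb]:
  assumes "dfb M s b P" "dfb M s b Q" shows "dfb M s b (\<lambda>e. P e \<longleftrightarrow> Q e)"
  using dfb_conj[OF dfb_imp[OF assms] dfb_imp[OF assms(2,1)]] by (rule dfb_cong) blast

lemma dfb_ex [dfb]:
  assumes "dfb M s b (\<lambda>e. P (e 0) (\<lambda>n. e (Suc n)))"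
  shows "dfb M s b (\<lambda>e. \<exists>x. P x e)"
  using dfb_neg[OF dfb_all[of M s b "\<lambda>x e. \<not> P x e", OF dfb_neg[OF assms]]] by simp

text \<open>Nested terms are flattened: existential quantifiers name the values of \<open>t\<close>
  and \<open>u\<close>, so only the graph of \<open>F\<close> has to be definable.\<close>

lemma deft_fun2:
  assumes "dfb M s b (\<lambda>e. e 0 = F (e (Suc 0)) (e (Suc (Suc 0))))" "deft M s b t" "deft M s b u"
  shows "deft M s b (\<lambda>e. F (t e) (u e))"
proof -
  have 1: "dfb M s b (\<lambda>e. e (Suc (Suc 0)) = F (e (Suc 0)) (e 0))"
    using dfb_ren[OF assms(1), where r = "case_nat (Suc (Suc 0)) (case_nat (Suc 0) (\<lambda>_. 0))"] by simp
  have 2: "dfb M s b (\<lambda>e. e 0 = t (\<lambda>n. e (Suc (Suc n))))"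
    using dfb_ren[OF assms(2)[unfolded deft_def], where r = "case_nat 0 (\<lambda>n. Suc (Suc n))"] by simp
  have 3: "dfb M s b (\<lambda>e. e 0 = u (\<lambda>n. e (Suc (Suc (Suc n)))))"
    using dfb_ren[OF assms(3)[unfolded deft_def], where r = "case_nat 0 (\<lambda>n. Suc (Suc (Suc n)))"] by simp
  have "dfb M s b (\<lambda>e. \<exists>x. x = t (\<lambda>n. e (Suc n)) \<and> (\<exists>y. y = u (\<lambda>n. e (Suc n)) \<and> e 0 = F x y))"
    by (intro dfb 1 2 3)
  then show ?thesis by (simp add: deft_def)
qed

lemma deft_fun1:
  assumes "dfb M s b (\<lambda>e. e 0 = F (e (Suc 0)))" "deft M s b t"
  shows "deft M s b (\<lambda>e. F (t e))"
  using deft_fun2[of M s b "\<lambda>x y. F x" t t] assms by simp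

lemma deft_shift: "deft M s b t \<Longrightarrow> deft M s b (\<lambda>e. t (\<lambda>n. e (Suc n)))"
  unfolding deft_def by (drule dfb_ren[where r = "case_nat 0 (\<lambda>n. Suc (Suc n))"]) simp

lemma dfb_subst2:
  assumes "dfb M s b (\<lambda>e. P (e 0) (e (Suc 0)))" "deft M s b t" "deft M s b u"
  shows "dfb M s b (\<lambda>e. P (t e) (u e))"
proof -
  have 1: "dfb M s b (\<lambda>e. P (e (Suc 0)) (e 0))"
    using dfb_ren[OF assms(1), where r = "\<lambda>n. if n = 0 then Suc 0 else 0"] by simp
  have 2: "dfb M s b (\<lambda>e. e 0 = u (\<lambda>n. e (Suc (Suc n))))"
    using deft_shift[OF assms(3)] unfolding deft_def .
  have "dfb M s b (\<lambda>e. \<exists>x. x = t e \<and> (\<exists>y. y = u e \<and> P x y))"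
    by (intro dfb 1 2 assms(2)[unfolded deft_def])
  then show ?thesis by simp
qed

lemma dfb_subst1:
  assumes "dfb M s b (\<lambda>e. P (e 0))" "deft M s b t"
  shows "dfb M s b (\<lambda>e. P (t e))"
  using dfb_subst2[of M s b "\<lambda>x y. P x" t t] assms by simp

text \<open>A parameter list is a total sequence, so even a formula without parameters must be given
  some object to fill it, and a standard one if \<open>s\<close> holds.\<close>

lemma deft_var:
  assumes "\<exists>x. st M x"
  shows "deft M s b (\<lambda>e. e i)"
proof -
  from assms obtain a where "st M a" ..
  then show ?thesis
    unfolding deft_def by (intro dfbI[of b "FEq 0 (2 * Suc i)" s M "\<lambda>_. a"]) (simp_all add: mix_def)
qed

lemma deft_const [dfb]:
  assumes "s \<longrightarrow> st M a"
  shows "deft M s b (\<lambda>e. a)"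
  unfolding deft_def using assms
  by (intro dfbI[of b "FEq 0 1" s M "\<lambda>_. a"]) (simp_all add: mix_def)

lemma dfb_atomic:
  assumes "\<exists>x. st M x"
  shows "dfb M s b (\<lambda>e. e 0 \<epsilon>\<^bsub>M\<^esub> e (Suc 0))" "dfb M s b (\<lambda>e. e 0 = e (Suc 0))"
    "dfb M s True (\<lambda>e. st M (e 0))"
proof -
  from assms obtain a where "st M a" ..
  then show "dfb M s b (\<lambda>e. e 0 \<epsilon>\<^bsub>M\<^esub> e (Suc 0))" "dfb M s b (\<lambda>e. e 0 = e (Suc 0))"
    "dfb M s True (\<lambda>e. st M (e 0))"
    by (intro dfbI[of b "FMem 0 2" s M "\<lambda>_. a"] dfbI[of b "FEq 0 2" s M "\<lambda>_. a"]
      dfbI[of True "FSt 0" s M "\<lambda>_. a"]; simp add: mix_def)+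
qed

section \<open>Set theory in a model\<close>

context BST_model
begin

lemma ex_st: "\<exists>x. st M x"
  using boundedness by blast

lemmas deft_var_ex_st [dfb] = deft_var[OF ex_st]

lemma dfb_mem [dfb]: "deft M s b t \<Longrightarrow> deft M s b u \<Longrightarrow> dfb M s b (\<lambda>e. t e \<epsilon> u e)"
  by (rule dfb_subst2[OF dfb_atomic(1)[OF ex_st]])

lemma dfb_eq [dfb]: "deft M s b t \<Longrightarrow> deft M s b u \<Longrightarrow> dfb M s b (\<lambda>e. t e = u e)"
  by (rule dfb_subst2[OF dfb_atomic(2)[OF ex_st]])

lemma dfb_st [dfb]: "deft M s True t \<Longrightarrow> dfb M s True (\<lambda>e. st M (t e))"
  by (rule dfb_subst1[OF dfb_atomic(3)[OF ex_st]])

lemma dfb_False [dfb]: "dfb M s b (\<lambda>e. False)"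
proof -
  have "dfb M s b (\<lambda>e. e 0 = e 0 \<and> \<not> e 0 = e 0)"
    by (intro dfb)
  then show ?thesis by simp
qed

text \<open>This recovers the shape in which the axiom schemes quantify over formulas. As
  \<open>P\<close> looks at \<open>e 0\<close> only, all argument positions may be collapsed to
  variable 0, and the parameters follow it.\<close>

lemma dfb_unary_formula:
  assumes "dfb M s b (\<lambda>e. P (e 0))"
  obtains \<phi> c where "b \<or> in_formula \<phi>" "s \<longrightarrow> (\<forall>i. st M (c i))" "\<And>x. P x \<longleftrightarrow> sat M (x ## c) \<phi>"
proof -
  from assms obtain \<phi> c where *: "b \<or> in_formula \<phi>" "s \<longrightarrow> (\<forall>i. st M (c i))"
    "\<And>e. P (e 0) \<longleftrightarrow> sat M (mix e c) \<phi>" unfolding dfb_def by blast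
  let ?r = "\<lambda>n. if even n then 0 else Suc (n div 2)"
  have "(\<lambda>i. (x ## c) (?r i)) = mix (\<lambda>_. x) c" for x
    by (rule ext) (simp add: mix_def)
  then show ?thesis
    using * *(3)[of "\<lambda>_. x" for x] by (intro that[of "ren ?r \<phi>" c]) simp_all
qed

section \<open>Separation, Transfer and Standardization for definable predicates\<close>

lemma separation_dfb:
  assumes "dfb M False False (\<lambda>e. P (e 0))"
  shows "\<exists>B. \<forall>x. x \<epsilon> B \<longleftrightarrow> x \<epsilon> A \<and> P x"
proof -
  obtain \<phi> c where "in_formula \<phi>" "\<And>x. P x \<longleftrightarrow> sat M (x ## c) \<phi>"
    using dfb_unary_formula[OF assms] by metis
  then show ?thesis using separation by presburger
qed

lemma transfer_all:
  assumes "dfb M True False (\<lambda>e. P (e 0))" "\<And>x. st M x \<Longrightarrow> P x"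
  shows "P x"
proof -
  obtain \<phi> c where "in_formula \<phi>" "\<forall>i. st M (c i)" "\<And>x. P x \<longleftrightarrow> sat M (x ## c) \<phi>"
    using dfb_unary_formula[OF assms(1)] by metis
  then show ?thesis using transfer assms(2) by presburger
qed

lemma transfer_ex:
  assumes "dfb M True False (\<lambda>e. P (e 0))" "P x"
  obtains y where "st M y" "P y"
  using transfer_all[OF dfb_neg[OF assms(1)]] assms(2) by blast

text \<open>One variable is transferred at a time: first \<open>y\<close>, with the standard
  \<open>x\<close> as a parameter, then \<open>x\<close>.\<close>

lemma transfer_all2:
  assumes "dfb M True False (\<lambda>e. P (e 0) (e (Suc 0)))" "\<And>x y. st M x \<Longrightarrow> st M y \<Longrightarrow> P x y"
  shows "P x y"
proof -
  have "dfb M True False (\<lambda>e. \<forall>y. P (e 0) y)"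
    by (intro dfb dfb_subst2[where P = P, OF assms(1)])
  moreover have "dfb M True False (\<lambda>e. P x (e 0))" if "st M x" for x
    using that by (intro dfb dfb_subst2[where P = P, OF assms(1)]; simp)
  then have "\<forall>y. P x y" if "st M x" for x
    using transfer_all assms(2) that by meson
  ultimately show ?thesis
    using transfer_all[of "\<lambda>x. \<forall>y. P x y"] by blast
qed

text \<open>Transfer supplies a standard solution of \<open>P\<close>, and uniqueness identifies it
  with \<open>x\<close>.\<close>

lemma st_unique:
  assumes "dfb M True False (\<lambda>e. P (e 0))" "P x" "\<And>y. P y \<Longrightarrow> y = x"
  shows "st M x"
  by (metis assms transfer_ex)

lemma st_deft: "deft M True False (\<lambda>e. x) \<Longrightarrow> st M x"
  unfolding deft_def by (rule st_unique[of "\<lambda>y. y = x"]) simp_all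

lemma standardization_dfb:
  assumes "dfb M False True (\<lambda>e. P (e 0))"
  shows "\<exists>S. st M S \<and> (\<forall>x. st M x \<longrightarrow> (x \<epsilon> S \<longleftrightarrow> x \<epsilon> A \<and> P x))"
proof -
  obtain \<phi> c where "\<And>x. P x \<longleftrightarrow> sat M (x ## c) \<phi>"
    using dfb_unary_formula[OF assms(1)] by metis
  then show ?thesis using standardization[of A c \<phi>] by presburger
qed

text \<open>Transfer extends the equivalence from standard to all elements. It yields the uniqueness
  that \<open>st_set\<close> relies on.\<close>

lemma st_ext:
  assumes "st M S" "st M T" "\<And>x. st M x \<Longrightarrow> x \<epsilon> S \<longleftrightarrow> x \<epsilon> T"
  shows "S = T"
proof (rule extensionality, rule allI)
  fix t
  show "t \<epsilon> S \<longleftrightarrow> t \<epsilon> T"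
    by (rule transfer_all[of "\<lambda>t. t \<epsilon> S \<longleftrightarrow> t \<epsilon> T"]) (use assms in \<open>auto intro!: dfb\<close>)
qed

lemma st_subs:
  assumes "st M S" "st M T" "\<And>x. st M x \<Longrightarrow> x \<epsilon> S \<Longrightarrow> x \<epsilon> T"
  shows "x \<epsilon> S \<longrightarrow> x \<epsilon> T"
  by (rule transfer_all[of "\<lambda>t. t \<epsilon> S \<longrightarrow> t \<epsilon> T"]) (use assms in \<open>auto intro!: dfb\<close>)

lemma st_set:
  assumes "dfb M False True (\<lambda>e. P (e 0))"
  shows "st M (st_set M A P)" "st M x \<Longrightarrow> x \<epsilon> st_set M A P \<longleftrightarrow> x \<epsilon> A \<and> P x"
proof -
  let ?Q = "\<lambda>S. st M S \<and> (\<forall>x. st M x \<longrightarrow> (x \<epsilon> S \<longleftrightarrow> x \<epsilon> A \<and> P x))"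
  obtain S where "?Q S"
    using standardization_dfb[where P = P and A = A, OF assms] by blast
  then have "?Q (st_set M A P)"
    unfolding st_set_def by (rule theI) (use \<open>?Q S\<close> st_ext in blast)
  then show "st M (st_set M A P)" "st M x \<Longrightarrow> x \<epsilon> st_set M A P \<longleftrightarrow> x \<epsilon> A \<and> P x"
    by blast+
qed

section \<open>Basic set operations, their definability and their standardness\<close>

lemma mem_setof:
  assumes "\<exists>z. \<forall>t. t \<epsilon> z \<longleftrightarrow> P t"
  shows "t \<epsilon> setof M P \<longleftrightarrow> P t"
proof -
  from assms obtain z where z: "\<forall>t. t \<epsilon> z \<longleftrightarrow> P t" ..
  have "\<forall>t. t \<epsilon> setof M P \<longleftrightarrow> P t"
    unfolding setof_def by (rule theI[of _ z]) (use z in \<open>auto intro: extensionality\<close>)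
  then show ?thesis ..
qed

lemma eq_iff_mem: "x = y \<longleftrightarrow> (\<forall>t. t \<epsilon> x \<longleftrightarrow> t \<epsilon> y)"
  using extensionality by blast

lemma mem_emp [simp]: "\<not> t \<epsilon> emp M"
  unfolding emp_def using separation_dfb[OF dfb_False] mem_setof[of "\<lambda>_. False"] by simp

lemma mem_upair [simp]: "t \<epsilon> upair M x y \<longleftrightarrow> t = x \<or> t = y"
  unfolding upair_def by (rule mem_setof) (rule pairing)

lemma mem_union [simp]: "t \<epsilon> union M x y \<longleftrightarrow> t \<epsilon> x \<or> t \<epsilon> y"
  unfolding union_def
proof (rule mem_setof)
  show "\<exists>z. \<forall>t. t \<epsilon> z \<longleftrightarrow> t \<epsilon> x \<or> t \<epsilon> y"
    using Union[of "upair M x y"] by auto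
qed

lemma mem_sdiff [simp]: "t \<epsilon> sdiff M x y \<longleftrightarrow> t \<epsilon> x \<and> \<not> t \<epsilon> y"
  unfolding sdiff_def by (rule mem_setof, rule separation_dfb) (intro dfb; simp)

lemma mem_powset [simp]: "t \<epsilon> powset M x \<longleftrightarrow> subs M t x"
  unfolding powset_def by (rule mem_setof) (use powerset in \<open>simp add: subs_def\<close>)

lemma opair_inject [simp]: "opair M x y = opair M x' y' \<longleftrightarrow> x = x' \<and> y = y'"
proof -
  have "upair M a b = upair M c d \<longleftrightarrow> (a = c \<and> b = d \<or> a = d \<and> b = c)" for a b c d
    by (auto simp: eq_iff_mem)
  then show ?thesis unfolding opair_def by metis
qed

lemma deft_upair [dfb]:
  assumes "deft M s b t" "deft M s b u"
  shows "deft M s b (\<lambda>e. upair M (t e) (u e))"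
proof (rule deft_fun2[OF _ assms])
  show "dfb M s b (\<lambda>e. e 0 = upair M (e (Suc 0)) (e (Suc (Suc 0))))"
    unfolding eq_iff_mem[of _ "upair M _ _"] mem_upair by (intro dfb)
qed

lemma deft_opair [dfb]:
  "deft M s b t \<Longrightarrow> deft M s b u \<Longrightarrow> deft M s b (\<lambda>e. opair M (t e) (u e))"
  unfolding opair_def by (intro dfb)

lemma deft_union [dfb]:
  assumes "deft M s b t" "deft M s b u"
  shows "deft M s b (\<lambda>e. union M (t e) (u e))"
proof (rule deft_fun2[OF _ assms])
  show "dfb M s b (\<lambda>e. e 0 = union M (e (Suc 0)) (e (Suc (Suc 0))))"
    unfolding eq_iff_mem[of _ "union M _ _"] mem_union by (intro dfb)
qed

lemma dfb_subs [dfb]: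
  "deft M s b t \<Longrightarrow> deft M s b u \<Longrightarrow> dfb M s b (\<lambda>e. subs M (t e) (u e))"
  by (rule dfb_subst2[where P = "\<lambda>x y. subs M x y"]) (unfold subs_def, intro dfb)

lemma mem_cartprod [simp]:
  "t \<epsilon> cartprod M A B \<longleftrightarrow> (\<exists>x y. x \<epsilon> A \<and> y \<epsilon> B \<and> t = opair M x y)"
  unfolding cartprod_def
proof (rule mem_setof)
  let ?P = "\<lambda>t. \<exists>x y. x \<epsilon> A \<and> y \<epsilon> B \<and> t = opair M x y"
  have "\<exists>z. \<forall>t. t \<epsilon> z \<longleftrightarrow> t \<epsilon> powset M (powset M (union M A B)) \<and> ?P t"
    by (rule separation_dfb) (intro dfb; simp)
  \<comment> \<open>Kuratowski pairs over \<open>A\<close> and \<open>B\<close> are sets of subsets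
    of \<open>union M A B\<close>, so the double power set is large enough for Separation.\<close>
  moreover have "t \<epsilon> powset M (powset M (union M A B))" if "?P t" for t
    using that by (auto simp: subs_def opair_def)
  ultimately show "\<exists>z. \<forall>t. t \<epsilon> z \<longleftrightarrow> ?P t" by metis
qed

lemma st_opair [simp]: "st M x \<Longrightarrow> st M y \<Longrightarrow> st M (opair M x y)"
  by (rule st_deft, rule deft_opair) (intro deft_const; simp)+

lemma st_union [simp]: "st M x \<Longrightarrow> st M y \<Longrightarrow> st M (union M x y)"
  by (rule st_deft, rule deft_union) (intro deft_const; simp)+

lemma st_emp [simp]: "st M (emp M)"
proof (rule st_unique[of "\<lambda>z. \<forall>t. \<not> t \<epsilon> z"])
  show "dfb M True False (\<lambda>e. \<forall>t. \<not> t \<epsilon> e 0)" by (intro dfb)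
qed (auto simp: eq_iff_mem)

lemma st_powset [simp]: "st M x \<Longrightarrow> st M (powset M x)"
proof (rule st_unique[of "\<lambda>z. \<forall>t. t \<epsilon> z \<longleftrightarrow> subs M t x"])
  assume "st M x"
  then show "dfb M True False (\<lambda>e. \<forall>t. t \<epsilon> e 0 \<longleftrightarrow> subs M t x)" by (intro dfb; simp)
qed (auto simp: eq_iff_mem)

text \<open>A total variant of \<^const>\<open>app\<close>, so that the term is definable without side conditions.\<close>

definition ap :: "'a \<Rightarrow> 'a \<Rightarrow> 'a" where
  "ap f x = (if \<exists>!y. opair M x y \<epsilon> f then THE y. opair M x y \<epsilon> f else x)"

text \<open>The right-hand side mentions only membership of pairs, equality and quantifiers, which
  puts the graph of \<open>ap\<close> within reach of the closure rules.\<close>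

lemma eq_ap_iff:
  "z = ap f x \<longleftrightarrow> (opair M x z \<epsilon> f \<and> (\<forall>y. opair M x y \<epsilon> f \<longrightarrow> y = z)) \<or>
    (\<not> (\<exists>y. opair M x y \<epsilon> f \<and> (\<forall>y'. opair M x y' \<epsilon> f \<longrightarrow> y' = y))) \<and> z = x"
proof (cases "\<exists>!y. opair M x y \<epsilon> f")
  case True
  then obtain y where y: "opair M x y \<epsilon> f" "\<And>y'. opair M x y' \<epsilon> f \<Longrightarrow> y' = y" by blast
  then have "(THE y. opair M x y \<epsilon> f) = y" by blast
  then have "ap f x = y" using True by (simp add: ap_def)
  then show ?thesis using y by blast
next
  case False
  then have "ap f x = x" unfolding ap_def by (rule if_not_P)
  then show ?thesis using False by metis
qed

lemma deft_ap [dfb]: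
  assumes "deft M s b t" "deft M s b u"
  shows "deft M s b (\<lambda>e. ap (t e) (u e))"
proof (rule deft_fun2[OF _ assms])
  show "dfb M s b (\<lambda>e. e 0 = ap (e (Suc 0)) (e (Suc (Suc 0))))"
    unfolding eq_ap_iff by (intro dfb)
qed

lemma st_ap [simp]: "st M x \<Longrightarrow> st M y \<Longrightarrow> st M (ap x y)"
  by (rule st_deft, rule deft_ap) (intro deft_const; simp)+

lemma app_eq_ap: "func_on M f D \<Longrightarrow> x \<epsilon> D \<Longrightarrow> app M f x = ap f x"
  unfolding ap_def app_def func_on_def by (subst if_P) blast+

lemma ap_eqI: "func_on M f D \<Longrightarrow> x \<epsilon> D \<Longrightarrow> opair M x y \<epsilon> f \<Longrightarrow> ap f x = y"
  using eq_ap_iff[of y f x] unfolding func_on_def by blast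

lemma opair_ap: "func_on M f D \<Longrightarrow> x \<epsilon> D \<Longrightarrow> opair M x (ap f x) \<epsilon> f"
  using ap_eqI[of f D x] unfolding func_on_def by blast

lemma dfb_func_on [dfb]:
  "deft M s b t \<Longrightarrow> deft M s b u \<Longrightarrow> dfb M s b (\<lambda>e. func_on M (t e) (u e))"
  by (rule dfb_subst2[where P = "\<lambda>x y. func_on M x y"]) (unfold func_on_def Ex1_def, intro dfb)

lemma maps_iff: "maps M f D C \<longleftrightarrow> func_on M f D \<and> (\<forall>x. x \<epsilon> D \<longrightarrow> ap f x \<epsilon> C)"
  unfolding maps_def using app_eq_ap by fastforce

lemma maps_ap: "maps M f D C \<Longrightarrow> x \<epsilon> D \<Longrightarrow> app M f x = ap f x"
  "maps M f D C \<Longrightarrow> x \<epsilon> D \<Longrightarrow> ap f x \<epsilon> C"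
  by (auto simp: maps_iff app_eq_ap)

lemma mem_funspace [simp]: "f \<epsilon> funspace M D C \<longleftrightarrow> maps M f D C"
  unfolding funspace_def
proof (rule mem_setof)
  have "\<exists>z. \<forall>t. t \<epsilon> z \<longleftrightarrow> t \<epsilon> powset M (cartprod M D C) \<and> maps M t D C"
    unfolding maps_iff by (rule separation_dfb) (intro dfb; simp)
  moreover have "t \<epsilon> powset M (cartprod M D C)" if "maps M t D C" for t
    unfolding mem_powset subs_def
  proof (intro allI impI)
    fix z assume "z \<epsilon> t"
    then obtain x y where "x \<epsilon> D" "z = opair M x y" "opair M x y \<epsilon> t"
      using \<open>maps M t D C\<close> unfolding maps_iff func_on_def by blast
    then show "z \<epsilon> cartprod M D C"
      using that ap_eqI[of t D x y] by (auto simp: maps_iff)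
  qed
  ultimately show "\<exists>z. \<forall>t. t \<epsilon> z \<longleftrightarrow> maps M t D C" by metis
qed

lemma st_funspace [simp]: "st M x \<Longrightarrow> st M y \<Longrightarrow> st M (funspace M x y)"
proof (rule st_unique[of "\<lambda>z. \<forall>f. f \<epsilon> z \<longleftrightarrow> maps M f x y"])
  assume "st M x" "st M y"
  then show "dfb M True False (\<lambda>e. \<forall>f. f \<epsilon> e 0 \<longleftrightarrow> maps M f x y)"
    unfolding maps_iff by (intro dfb; simp)
qed (auto simp: eq_iff_mem)

text \<open>The axiom of choice speaks of transversals of disjoint families. It is applied to the
  fibres of the relation \<open>P\<close> over the points of \<open>D\<close>; these are disjoint
  because every pair remembers its first coordinate.\<close>

lemma ex_function:
  assumes P: "dfb M False False (\<lambda>e. P (e 0) (e (Suc 0)))"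
    and ex: "\<And>x. x \<epsilon> D \<Longrightarrow> \<exists>y. y \<epsilon> C \<and> P x y"
  shows "\<exists>f. maps M f D C \<and> (\<forall>x. x \<epsilon> D \<longrightarrow> P x (ap f x))"
proof -
  note P' = dfb_subst2[where P = P, OF P]
  have "\<exists>G. \<forall>z. z \<epsilon> G \<longleftrightarrow> z \<epsilon> cartprod M D C \<and> (\<exists>x y. z = opair M x y \<and> P x y)"
    by (rule separation_dfb) (intro dfb P')
  then obtain G where G: "\<And>z. z \<epsilon> G \<longleftrightarrow> (\<exists>x y. z = opair M x y \<and> x \<epsilon> D \<and> y \<epsilon> C \<and> P x y)"
    unfolding mem_cartprod using opair_inject by metis
  \<comment> \<open>\<open>F\<close> is the family of fibres of \<open>G\<close>, one for each point
    of \<open>D\<close>.\<close>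
  have "\<exists>F. \<forall>s. s \<epsilon> F \<longleftrightarrow> s \<epsilon> powset M G \<and>
    (\<exists>x. x \<epsilon> D \<and> (\<forall>z. z \<epsilon> s \<longleftrightarrow> z \<epsilon> G \<and> (\<exists>y. z = opair M x y)))"
    by (rule separation_dfb) (intro dfb; simp)
  then obtain F where F: "\<And>s. s \<epsilon> F \<longleftrightarrow> s \<epsilon> powset M G \<and>
    (\<exists>x. x \<epsilon> D \<and> (\<forall>z. z \<epsilon> s \<longleftrightarrow> z \<epsilon> G \<and> (\<exists>y. z = opair M x y)))" by blast
  have fibre: "\<exists>s. s \<epsilon> F \<and> (\<forall>z. z \<epsilon> s \<longleftrightarrow> z \<epsilon> G \<and> (\<exists>y. z = opair M x y))" if "x \<epsilon> D" for x
  proof -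
    have "\<exists>s. \<forall>z. z \<epsilon> s \<longleftrightarrow> z \<epsilon> G \<and> (\<exists>y. z = opair M x y)"
      by (rule separation_dfb) (intro dfb; simp)
    then show ?thesis using that by (auto simp: F subs_def)
  qed
  have "\<exists>c. \<forall>s. s \<epsilon> F \<longrightarrow> (\<exists>!t. t \<epsilon> s \<and> t \<epsilon> c)"
  proof (rule choice; intro allI impI)
    fix s assume "s \<epsilon> F"
    then obtain x where "x \<epsilon> D" "\<And>z. z \<epsilon> s \<longleftrightarrow> z \<epsilon> G \<and> (\<exists>y. z = opair M x y)"
      by (auto simp: F)
    then show "\<exists>t. t \<epsilon> s" using ex[of x] G by blast
  next
    fix s s' assume "s \<epsilon> F \<and> s' \<epsilon> F \<and> s \<noteq> s'"
    then show "\<not> (\<exists>t. t \<epsilon> s \<and> t \<epsilon> s')"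
      unfolding F eq_iff_mem[of s s'] by (metis opair_inject)
  qed
  then obtain c where c: "\<And>s. s \<epsilon> F \<Longrightarrow> \<exists>!t. t \<epsilon> s \<and> t \<epsilon> c" by blast
  \<comment> \<open>The transversal \<open>c\<close> may contain further sets, so it is cut down to
    \<open>G\<close>.\<close>
  have "\<exists>f. \<forall>z. z \<epsilon> f \<longleftrightarrow> z \<epsilon> G \<and> z \<epsilon> c"
    by (rule separation_dfb) (intro dfb; simp)
  then obtain f where f: "\<And>z. z \<epsilon> f \<longleftrightarrow> z \<epsilon> G \<and> z \<epsilon> c" by blast
  have ex1: "\<exists>!y. opair M x y \<epsilon> f" if x: "x \<epsilon> D" for x
  proof -
    obtain s where s: "s \<epsilon> F" "\<And>z. z \<epsilon> s \<longleftrightarrow> z \<epsilon> G \<and> (\<exists>y. z = opair M x y)"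
      using fibre[OF x] by blast
    obtain t where t: "t \<epsilon> s" "t \<epsilon> c" "\<And>t'. t' \<epsilon> s \<Longrightarrow> t' \<epsilon> c \<Longrightarrow> t' = t"
      using c[OF s(1)] by blast
    then obtain y where y: "t = opair M x y" using s(2) by blast
    show ?thesis
    proof (rule ex1I[of _ y])
      show "opair M x y \<epsilon> f" using t(1,2) s(2) f y by blast
    next
      fix y' assume "opair M x y' \<epsilon> f"
      then have "opair M x y' = t" using t(3) s(2) f by blast
      then show "y' = y" using y by simp
    qed
  qed
  have fon: "func_on M f D"
    unfolding func_on_def
  proof (intro conjI allI impI ex1)
    fix t assume "t \<epsilon> f"
    then show "\<exists>x y. x \<epsilon> D \<and> t = opair M x y" using f G by blast
  qed
  have "opair M x (ap f x) \<epsilon> G" if "x \<epsilon> D" for x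
    using opair_ap[OF fon that] f by blast
  then have "ap f x \<epsilon> C \<and> P x (ap f x)" if "x \<epsilon> D" for x
    using that G[of "opair M x (ap f x)"] by auto
  then show ?thesis using fon by (auto simp: maps_iff)
qed

lemma dfb_weaken: "dfb M s b P \<Longrightarrow> dfb M False b P"
  unfolding dfb_def by blast

text \<open>Choice gives some function with the required property. That property has only standard
  parameters and does not mention \<open>st\<close>, so transfer replaces the function by a standard
  one.\<close>

lemma ex_st_function:
  assumes P: "dfb M True False (\<lambda>e. P (e 0) (e (Suc 0)))" and st: "st M D" "st M C"
    and ex: "\<And>x. x \<epsilon> D \<Longrightarrow> \<exists>y. y \<epsilon> C \<and> P x y"
  obtains f where "st M f" "maps M f D C" "\<And>x. x \<epsilon> D \<Longrightarrow> P x (ap f x)"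
proof -
  have "dfb M True False (\<lambda>e. maps M (e 0) D C \<and> (\<forall>x. x \<epsilon> D \<longrightarrow> P x (ap (e 0) x)))"
    unfolding maps_iff using st by (intro dfb dfb_subst2[where P = P, OF P]; simp)
  moreover have "\<exists>f. maps M f D C \<and> (\<forall>x. x \<epsilon> D \<longrightarrow> P x (ap f x))"
    using dfb_weaken[OF P] ex by (rule ex_function[where P = P])
  ultimately obtain f where "st M f" "maps M f D C \<and> (\<forall>x. x \<epsilon> D \<longrightarrow> P x (ap f x))"
    using transfer_ex[of "\<lambda>f. maps M f D C \<and> (\<forall>x. x \<epsilon> D \<longrightarrow> P x (ap f x))"] by blast
  then show ?thesis using that by blast
qed

text \<open>Here \<open>P\<close> may be external, and \<open>f\<close> has the required property at standard arguments.\<close>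

lemma ex_st_function_external:
  assumes P: "dfb M False True (\<lambda>e. P (e 0) (e (Suc 0)))" and st: "st M D" "st M C"
    and ex: "\<And>x. st M x \<Longrightarrow> x \<epsilon> D \<Longrightarrow> \<exists>y. st M y \<and> y \<epsilon> C \<and> P x y"
  obtains f where "st M f" "maps M f D C" "\<And>x. st M x \<Longrightarrow> x \<epsilon> D \<Longrightarrow> P x (ap f x)"
proof -
  have "dfb M False True (\<lambda>e. \<exists>x y. e 0 = opair M x y \<and> P x y)"
    by (intro dfb dfb_subst2[where P = P, OF P])
  \<comment> \<open>Standardization replaces the external relation by a standard set of pairs with
    the same standard elements, and the internal version of the lemma applies to that set.\<close>
  then obtain S where S: "st M S" "\<And>z. st M z \<Longrightarrow> z \<epsilon> S \<longleftrightarrow> z \<epsilon> cartprod M D C \<and> (\<exists>x y. z = opair M x y \<and> P x y)"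
    using standardization_dfb[where P = "\<lambda>z. \<exists>x y. z = opair M x y \<and> P x y" and A = "cartprod M D C"] by blast
  have d: "dfb M True False (\<lambda>e. opair M (e 0) (e (Suc 0)) \<epsilon> S)"
    using S by (intro dfb; simp)
  have "x \<epsilon> D \<longrightarrow> (\<exists>y. y \<epsilon> C \<and> opair M x y \<epsilon> S)" for x
  proof (rule transfer_all[of "\<lambda>x. x \<epsilon> D \<longrightarrow> (\<exists>y. y \<epsilon> C \<and> opair M x y \<epsilon> S)"])
    show "dfb M True False (\<lambda>e. e 0 \<epsilon> D \<longrightarrow> (\<exists>y. y \<epsilon> C \<and> opair M (e 0) y \<epsilon> S))"
      using S(1) st by (intro dfb; simp)
  next
    fix x assume "st M x"
    show "x \<epsilon> D \<longrightarrow> (\<exists>y. y \<epsilon> C \<and> opair M x y \<epsilon> S)"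
    proof
      assume "x \<epsilon> D"
      then obtain y where "st M y" "y \<epsilon> C" "P x y" using ex \<open>st M x\<close> by blast
      then show "\<exists>y. y \<epsilon> C \<and> opair M x y \<epsilon> S"
        using S(2)[of "opair M x y"] \<open>x \<epsilon> D\<close> \<open>st M x\<close> by auto
    qed
  qed
  then obtain f where f: "st M f" "maps M f D C" "\<And>x. x \<epsilon> D \<Longrightarrow> opair M x (ap f x) \<epsilon> S"
    using ex_st_function[where P = "\<lambda>x y. opair M x y \<epsilon> S", OF d st] by metis
  \<comment> \<open>For standard \<open>x\<close> the value \<open>ap f x\<close> is standard too,
    hence so is the pair, and its membership in \<open>S\<close> can be read back as
    \<open>P\<close>.\<close>
  have "P x (ap f x)" if "st M x" "x \<epsilon> D" for x
    using f(3)[OF that(2)] S(2)[of "opair M x (ap f x)"] that f(1) by auto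
  then show ?thesis using f(1,2) that by blast
qed

end

section \<open>Reals in a model\<close>

locale BST_reals = BST_model +
  fixes R :: "'a real_structure"
  assumes standard_reals: "standard_reals M R"
begin

abbreviation plus (infixl "\<oplus>" 65) where "x \<oplus> y \<equiv> plus_r M R x y"
abbreviation times (infixl "\<otimes>" 70) where "x \<otimes> y \<equiv> times_r M R x y"
abbreviation less (infix "\<prec>" 50) where "x \<prec> y \<equiv> less_r M R x y"
abbreviation le (infix "\<preceq>" 50) where "x \<preceq> y \<equiv> le_r M R x y"
abbreviation zero ("\<zero>") where "\<zero> \<equiv> rzero R"
abbreviation one ("\<one>") where "\<one> \<equiv> rone R"
abbreviation neg ("\<ominus> _" [81] 80) where "\<ominus> x \<equiv> uminus_r M R x"
abbreviation Re where "Re x \<equiv> is_real M R x"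
abbreviation N where "N \<equiv> nats M R"

lemma complete: "complete_ordered_field M R"
  using standard_reals by (simp add: standard_reals_def)

lemma st_components [simp]: "st M (rcar R)" "st M (radd R)" "st M (rmul R)" "st M \<zero>" "st M \<one>"
  "st M (rlt R)" "st M (rinf R)"
  and rinf_not_real [simp]: "\<not> Re (rinf R)"
  using standard_reals by (auto simp: standard_reals_def)

lemma
  maps_radd: "maps M (radd R) (cartprod M (rcar R) (rcar R)) (rcar R)" and
  maps_rmul: "maps M (rmul R) (cartprod M (rcar R) (rcar R)) (rcar R)" and
  rlt_subs: "subs M (rlt R) (cartprod M (rcar R) (rcar R))" and
  real_0_1 [simp]: "Re \<zero>" "Re \<one>" and
  zero_neq_one: "\<zero> \<noteq> \<one>"
  using complete unfolding complete_ordered_field_def by blast+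

lemma add_assoc: "Re x \<Longrightarrow> Re y \<Longrightarrow> Re z \<Longrightarrow> (x \<oplus> y) \<oplus> z = x \<oplus> (y \<oplus> z)"
  and add_comm: "Re x \<Longrightarrow> Re y \<Longrightarrow> x \<oplus> y = y \<oplus> x"
  and mult_assoc: "Re x \<Longrightarrow> Re y \<Longrightarrow> Re z \<Longrightarrow> (x \<otimes> y) \<otimes> z = x \<otimes> (y \<otimes> z)"
  and mult_comm: "Re x \<Longrightarrow> Re y \<Longrightarrow> x \<otimes> y = y \<otimes> x"
  and distrib: "Re x \<Longrightarrow> Re y \<Longrightarrow> Re z \<Longrightarrow> x \<otimes> (y \<oplus> z) = x \<otimes> y \<oplus> x \<otimes> z"
  and less_trans: "Re x \<Longrightarrow> Re y \<Longrightarrow> Re z \<Longrightarrow> x \<prec> y \<Longrightarrow> y \<prec> z \<Longrightarrow> x \<prec> z"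
  and add_less: "Re x \<Longrightarrow> Re y \<Longrightarrow> Re z \<Longrightarrow> x \<prec> y \<Longrightarrow> x \<oplus> z \<prec> y \<oplus> z"
  and mult_less: "Re x \<Longrightarrow> Re y \<Longrightarrow> Re z \<Longrightarrow> x \<prec> y \<Longrightarrow> \<zero> \<prec> z \<Longrightarrow> x \<otimes> z \<prec> y \<otimes> z"
  using complete unfolding complete_ordered_field_def by metis+

lemma add_0 [simp]: "Re x \<Longrightarrow> \<zero> \<oplus> x = x"
  and mult_1 [simp]: "Re x \<Longrightarrow> \<one> \<otimes> x = x"
  and less_irrefl [simp]: "Re x \<Longrightarrow> \<not> x \<prec> x"
  and ex_neg: "Re x \<Longrightarrow> \<exists>y. Re y \<and> x \<oplus> y = \<zero>"
  and ex_inverse: "Re x \<Longrightarrow> x \<noteq> \<zero> \<Longrightarrow> \<exists>y. Re y \<and> x \<otimes> y = \<one>"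
  and linear: "Re x \<Longrightarrow> Re y \<Longrightarrow> x \<prec> y \<or> x = y \<or> y \<prec> x"
  using complete unfolding complete_ordered_field_def by metis+

lemma ex_sup:
  "subs M C (rcar R) \<Longrightarrow> x \<epsilon> C \<Longrightarrow> Re b \<Longrightarrow> (\<And>x. x \<epsilon> C \<Longrightarrow> x \<preceq> b) \<Longrightarrow>
   \<exists>s. Re s \<and> (\<forall>x. x \<epsilon> C \<longrightarrow> x \<preceq> s) \<and> (\<forall>b. Re b \<and> (\<forall>x. x \<epsilon> C \<longrightarrow> x \<preceq> b) \<longrightarrow> s \<preceq> b)"
  using complete unfolding complete_ordered_field_def by blast

text \<open>As for \<^const>\<open>ap\<close>, total variants of the operations are definable unconditionally.\<close>

definition padd :: "'a \<Rightarrow> 'a \<Rightarrow> 'a" where "padd x y = ap (radd R) (opair M x y)"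
definition pmul :: "'a \<Rightarrow> 'a \<Rightarrow> 'a" where "pmul x y = ap (rmul R) (opair M x y)"

lemma add_eq: "Re x \<Longrightarrow> Re y \<Longrightarrow> x \<oplus> y = padd x y"
  unfolding plus_r_def padd_def is_real_def by (rule maps_ap[OF maps_radd]) simp

lemma mul_eq: "Re x \<Longrightarrow> Re y \<Longrightarrow> x \<otimes> y = pmul x y"
  unfolding times_r_def pmul_def is_real_def by (rule maps_ap[OF maps_rmul]) simp

lemma add_closed [simp]: "Re x \<Longrightarrow> Re y \<Longrightarrow> Re (x \<oplus> y)"
  using maps_ap(2)[OF maps_radd, of "opair M x y"] by (simp add: add_eq padd_def is_real_def)

lemma mul_closed [simp]: "Re x \<Longrightarrow> Re y \<Longrightarrow> Re (x \<otimes> y)"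
  using maps_ap(2)[OF maps_rmul, of "opair M x y"] by (simp add: mul_eq pmul_def is_real_def)

lemma deft_padd [dfb]: "deft M s b t \<Longrightarrow> deft M s b u \<Longrightarrow> deft M s b (\<lambda>e. padd (t e) (u e))"
  unfolding padd_def by (intro deft_ap deft_opair deft_const) simp_all

lemma deft_pmul [dfb]: "deft M s b t \<Longrightarrow> deft M s b u \<Longrightarrow> deft M s b (\<lambda>e. pmul (t e) (u e))"
  unfolding pmul_def by (intro deft_ap deft_opair deft_const) simp_all

lemma dfb_less [dfb]: "deft M s b t \<Longrightarrow> deft M s b u \<Longrightarrow> dfb M s b (\<lambda>e. t e \<prec> u e)"
  unfolding less_r_def by (intro dfb_mem deft_opair deft_const; simp)

lemma dfb_le [dfb]: "deft M s b t \<Longrightarrow> deft M s b u \<Longrightarrow> dfb M s b (\<lambda>e. t e \<preceq> u e)"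
  unfolding le_r_def by (intro dfb)

lemma dfb_real [dfb]: "deft M s b t \<Longrightarrow> dfb M s b (\<lambda>e. Re (t e))"
  unfolding is_real_def by (intro dfb_mem deft_const; simp)

lemma st_add [simp]: "Re x \<Longrightarrow> Re y \<Longrightarrow> st M x \<Longrightarrow> st M y \<Longrightarrow> st M (x \<oplus> y)"
  by (simp add: add_eq padd_def)

lemma mem_rcar: "x \<epsilon> rcar R \<longleftrightarrow> Re x"
  by (simp add: is_real_def)

lemma less_real: "x \<prec> y \<Longrightarrow> Re x" "x \<prec> y \<Longrightarrow> Re y"
  using rlt_subs unfolding less_r_def subs_def mem_cartprod is_real_def by (metis opair_inject)+

section \<open>Arithmetic of the ordered field\<close>

lemma add_0_right [simp]: "Re x \<Longrightarrow> x \<oplus> \<zero> = x"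
  using add_comm[of x \<zero>] by simp

lemma add_left_comm: "Re x \<Longrightarrow> Re y \<Longrightarrow> Re z \<Longrightarrow> x \<oplus> (y \<oplus> z) = y \<oplus> (x \<oplus> z)"
  using add_assoc[of x y z] add_assoc[of y x z] add_comm[of x y] by simp

lemma
  assumes "Re x"
  shows neg_closed [simp]: "Re (\<ominus> x)" and add_neg [simp]: "x \<oplus> \<ominus> x = \<zero>"
proof -
  obtain y where y: "Re y" "x \<oplus> y = \<zero>" using ex_neg[OF assms] by blast
  have u: "z = y" if z: "Re z" "x \<oplus> z = \<zero>" for z
    using add_assoc[of z x y] assms y z add_comm[of z x] by simp
  have "\<ominus> x = y"
    unfolding uminus_r_def by (rule the_equality) (use y u in blast)+
  then show "Re (\<ominus> x)" "x \<oplus> \<ominus> x = \<zero>" using y by simp_all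
qed

lemma neg_add [simp]: "Re x \<Longrightarrow> \<ominus> x \<oplus> x = \<zero>"
  using add_comm[of x "\<ominus> x"] by simp

lemma add_neg_cancel: "Re x \<Longrightarrow> Re y \<Longrightarrow> (x \<oplus> y) \<oplus> \<ominus> y = x" "Re x \<Longrightarrow> Re y \<Longrightarrow> (x \<oplus> \<ominus> y) \<oplus> y = x"
  by (simp_all add: add_assoc)

lemma add_left_cancel: "Re x \<Longrightarrow> Re y \<Longrightarrow> Re z \<Longrightarrow> x \<oplus> z = y \<oplus> z \<longleftrightarrow> x = y"
  by (metis add_neg_cancel(1))

lemma add_less_iff: "Re x \<Longrightarrow> Re y \<Longrightarrow> Re z \<Longrightarrow> x \<oplus> z \<prec> y \<oplus> z \<longleftrightarrow> x \<prec> y"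
  using add_less add_less[of "x \<oplus> z" "y \<oplus> z" "\<ominus> z"] by (auto simp: add_neg_cancel)

lemma st_neg [simp]:
  assumes "Re x" "st M x" shows "st M (\<ominus> x)"
proof (rule st_unique[of "\<lambda>y. Re y \<and> padd x y = \<zero>"])
  show "dfb M True False (\<lambda>e. Re (e 0) \<and> padd x (e 0) = \<zero>)"
    using assms by (intro dfb; simp)
  show "Re (\<ominus> x) \<and> padd x (\<ominus> x) = \<zero>"
    using assms by (simp add: add_eq[symmetric])
  fix y assume "Re y \<and> padd x y = \<zero>"
  then show "y = \<ominus> x"
    using assms add_left_cancel[of y "\<ominus> x" x] add_comm[of x y] by (simp add: add_eq[of x y])
qed

lemma less_asym: "x \<prec> y \<Longrightarrow> \<not> y \<prec> x"
  using less_trans less_irrefl less_real by metis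

lemma not_less: "Re x \<Longrightarrow> Re y \<Longrightarrow> \<not> x \<prec> y \<longleftrightarrow> y \<preceq> x"
  unfolding le_r_def using linear less_asym less_irrefl by metis

lemma le_refl [simp]: "x \<preceq> x"
  by (simp add: le_r_def)

lemma le_less_trans: "x \<preceq> y \<Longrightarrow> y \<prec> z \<Longrightarrow> x \<prec> z"
  unfolding le_r_def using less_trans less_real by metis

lemma less_le_trans: "x \<prec> y \<Longrightarrow> y \<preceq> z \<Longrightarrow> x \<prec> z"
  unfolding le_r_def using less_trans less_real by metis

lemma le_trans: "x \<preceq> y \<Longrightarrow> y \<preceq> z \<Longrightarrow> x \<preceq> z"
  unfolding le_r_def using less_trans less_real by metis

lemma less_imp_le: "x \<prec> y \<Longrightarrow> x \<preceq> y"
  by (simp add: le_r_def)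

lemma add_le: "Re x \<Longrightarrow> Re y \<Longrightarrow> Re z \<Longrightarrow> x \<preceq> y \<Longrightarrow> x \<oplus> z \<preceq> y \<oplus> z"
  unfolding le_r_def using add_less by metis

lemma add_less_mono: "x \<prec> y \<Longrightarrow> u \<prec> v \<Longrightarrow> x \<oplus> u \<prec> y \<oplus> v"
proof -
  assume a: "x \<prec> y" "u \<prec> v"
  note r = less_real[OF a(1)] less_real[OF a(2)]
  have "x \<oplus> u \<prec> y \<oplus> u" "y \<oplus> u \<prec> y \<oplus> v"
    using a r add_less[of x y u] add_less[of u v y] by (simp_all add: add_comm)
  then show ?thesis using less_trans r by (meson add_closed)
qed

lemma less_add_pos: "Re x \<Longrightarrow> \<zero> \<prec> e \<Longrightarrow> x \<prec> x \<oplus> e"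
  using add_less[of \<zero> e x] less_real[of \<zero> e] by (simp add: add_comm)

lemma le_add_nonneg: "Re x \<Longrightarrow> \<zero> \<preceq> e \<Longrightarrow> x \<preceq> x \<oplus> e"
  using less_add_pos[of x e] by (auto simp: le_r_def)

lemma mult_0 [simp]: "Re x \<Longrightarrow> \<zero> \<otimes> x = \<zero>"
proof -
  assume x: "Re x"
  have "x \<otimes> \<zero> \<oplus> x \<otimes> \<zero> = \<zero> \<oplus> x \<otimes> \<zero>"
    using distrib[of x \<zero> \<zero>] x by simp
  then show ?thesis using add_left_cancel[of "x \<otimes> \<zero>" \<zero> "x \<otimes> \<zero>"] x by (simp add: mult_comm)
qed

lemma neg_pos: "x \<prec> \<zero> \<Longrightarrow> \<zero> \<prec> \<ominus> x"
  using add_less[of x \<zero> "\<ominus> x"] less_real[of x \<zero>] by simp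

text \<open>If 1 were negative, then -1 would be positive, and multiplying 1 < 0 by it would make -1
  negative as well.\<close>

lemma zero_less_one: "\<zero> \<prec> \<one>"
proof (rule ccontr)
  assume "\<not> ?thesis"
  then have 1: "\<one> \<prec> \<zero>" using linear[of \<zero> \<one>] zero_neq_one by auto
  then have "\<one> \<otimes> \<ominus> \<one> \<prec> \<zero> \<otimes> \<ominus> \<one>" by (intro mult_less neg_pos) simp_all
  then show False using neg_pos[OF 1] less_asym by simp
qed

lemma less_succ: "Re x \<Longrightarrow> x \<prec> x \<oplus> \<one>"
  by (rule less_add_pos[OF _ zero_less_one])

text \<open>Trades the absolute value and the subtraction for two inequalities between sums, the
  form in which nearness is handled below.\<close>

lemma abs_diff_less_iff:
  assumes "Re r" "Re s" "\<zero> \<prec> e"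
  shows "abs_r M R (r \<oplus> \<ominus> s) \<prec> e \<longleftrightarrow> r \<prec> s \<oplus> e \<and> s \<prec> r \<oplus> e"
proof -
  let ?d = "r \<oplus> \<ominus> s"
  have e: "Re e" using assms less_real by blast
  have d: "Re ?d" "?d \<oplus> s = r" using assms by (simp_all add: add_neg_cancel)
  show ?thesis
  proof (cases "?d \<prec> \<zero>")
    case True
    have "\<ominus> ?d \<prec> e \<longleftrightarrow> \<ominus> ?d \<oplus> r \<prec> e \<oplus> r"
      using d e assms by (intro add_less_iff[symmetric]) simp_all
    also have "\<ominus> ?d \<oplus> r = s"
      using d assms add_assoc[of "\<ominus> ?d" ?d s] by simp
    finally have "\<ominus> ?d \<prec> e \<longleftrightarrow> s \<prec> r \<oplus> e" using e assms by (simp add: add_comm)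
    moreover have "r \<prec> s" using add_less[OF _ _ _ True, of s] d assms by simp
    then have "r \<prec> s \<oplus> e" using less_add_pos[of s e] assms less_trans e by (meson add_closed)
    ultimately show ?thesis using True by (simp add: abs_r_def)
  next
    case False
    have "?d \<prec> e \<longleftrightarrow> ?d \<oplus> s \<prec> e \<oplus> s"
      using d e assms by (intro add_less_iff[symmetric]) simp_all
    then have "?d \<prec> e \<longleftrightarrow> r \<prec> s \<oplus> e" using d e assms by (simp add: add_comm)
    moreover have "s \<preceq> r" using False add_le[of \<zero> ?d s] d assms not_less by simp
    then have "s \<prec> r \<oplus> e" using less_add_pos[of r e] assms le_less_trans by blast
    ultimately show ?thesis using False by (simp add: abs_r_def)
  qed
qed

lemma half:
  assumes "\<zero> \<prec> d"
  shows "\<exists>h. \<zero> \<prec> h \<and> h \<oplus> h = d"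
proof -
  have d: "Re d" using assms less_real by blast
  have "\<zero> \<prec> \<one> \<oplus> \<one>" using add_less_mono[OF zero_less_one zero_less_one] by simp
  then have "\<one> \<oplus> \<one> \<noteq> \<zero>" using less_irrefl[of \<zero>] by auto
  then obtain i where i: "Re i" "(\<one> \<oplus> \<one>) \<otimes> i = \<one>" using ex_inverse[of "\<one> \<oplus> \<one>"] by auto
  let ?h = "d \<otimes> i"
  have "?h \<oplus> ?h = d \<otimes> (i \<oplus> i)" using d i distrib by simp
  also have "i \<oplus> i = (\<one> \<oplus> \<one>) \<otimes> i"
    using i distrib[of i \<one> \<one>] by (simp add: mult_comm[of _ i]) (simp add: mult_comm[of i \<one>])
  finally have h: "?h \<oplus> ?h = d" using i d mult_comm[of d \<one>] by simp
  have "\<zero> \<prec> ?h"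
  proof (rule ccontr)
    assume "\<not> ?thesis"
    then have "?h \<preceq> \<zero>" using d i not_less by simp
    then have "?h \<oplus> ?h \<preceq> \<zero>"
      using add_le[of ?h \<zero> ?h] d i le_trans by simp
    then have "d \<prec> d" using h less_le_trans[OF assms] le_less_trans assms by simp
    then show False using d by simp
  qed
  then show ?thesis using h by blast
qed

lemma st_half:
  assumes "\<zero> \<prec> d" "st M d"
  obtains h where "\<zero> \<prec> h" "st M h" "h \<oplus> h = d"
proof -
  have "dfb M True False (\<lambda>e. \<zero> \<prec> e 0 \<and> padd (e 0) (e 0) = d)"
    using assms by (intro dfb; simp)
  moreover obtain h where "\<zero> \<prec> h \<and> padd h h = d"
    using half[OF assms(1)] add_eq less_real by metis
  ultimately obtain h where h: "st M h" "\<zero> \<prec> h" "padd h h = d"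
    using transfer_ex[of "\<lambda>h. \<zero> \<prec> h \<and> padd h h = d"] by blast
  have "Re h" using h(2) less_real by blast
  then show ?thesis using that h add_eq by metis
qed

subsection \<open>Natural numbers\<close>

lemma mem_nats: "n \<epsilon> N \<longleftrightarrow> Re n \<and>
  (\<forall>J. subs M J (rcar R) \<and> \<zero> \<epsilon> J \<and> (\<forall>x. x \<epsilon> J \<longrightarrow> padd x \<one> \<epsilon> J) \<longrightarrow> n \<epsilon> J)" (is "_ \<longleftrightarrow> ?P n")
proof -
  \<comment> \<open>Inside the reals \<open>padd\<close> agrees with addition. The replacement turns
    the defining condition of \<open>nats\<close> into one that the closure rules recognize as
    definable.\<close>
  have *: "(subs M J (rcar R) \<and> \<zero> \<epsilon> J \<and> (\<forall>x. x \<epsilon> J \<longrightarrow> padd x \<one> \<epsilon> J)) \<longleftrightarrow>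
    (subs M J (rcar R) \<and> \<zero> \<epsilon> J \<and> (\<forall>x. x \<epsilon> J \<longrightarrow> x \<oplus> \<one> \<epsilon> J))" for J
    by (auto simp: subs_def add_eq mem_rcar)
  have "\<exists>z. \<forall>n. n \<epsilon> z \<longleftrightarrow> n \<epsilon> rcar R \<and> ?P n"
    by (rule separation_dfb) (intro dfb; simp)
  then have "\<exists>z. \<forall>n. n \<epsilon> z \<longleftrightarrow> ?P n" by (simp add: mem_rcar conj_ac)
  then show ?thesis unfolding nats_def *[symmetric] by (rule mem_setof)
qed

lemma nats_real [simp]: "n \<epsilon> N \<Longrightarrow> Re n"
  by (simp add: mem_nats)

lemma zero_nats [simp]: "\<zero> \<epsilon> N"
  by (simp add: mem_nats)

lemma succ_nats [simp]: "n \<epsilon> N \<Longrightarrow> n \<oplus> \<one> \<epsilon> N"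
  by (simp add: mem_nats) (simp add: add_eq)

lemma st_nats [simp]: "st M N"
proof (rule st_unique)
  let ?P = "\<lambda>z. \<forall>n. n \<epsilon> z \<longleftrightarrow> Re n \<and>
    (\<forall>J. subs M J (rcar R) \<and> \<zero> \<epsilon> J \<and> (\<forall>x. x \<epsilon> J \<longrightarrow> padd x \<one> \<epsilon> J) \<longrightarrow> n \<epsilon> J)"
  show "dfb M True False (\<lambda>e. ?P (e 0))" by (intro dfb; simp)
  show "?P N" using mem_nats by blast
  show "y = N" if "?P y" for y
    using that mem_nats by (auto intro: extensionality)
qed

lemma nats_induct:
  assumes "n \<epsilon> N" "dfb M False False (\<lambda>e. P (e 0))" "P \<zero>" "\<And>n. n \<epsilon> N \<Longrightarrow> P n \<Longrightarrow> P (n \<oplus> \<one>)"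
  shows "P n"
proof -
  obtain J where J: "\<And>x. x \<epsilon> J \<longleftrightarrow> x \<epsilon> N \<and> P x"
    using separation_dfb[of P N] assms(2) by blast
  have "padd x \<one> \<epsilon> J" if "x \<epsilon> J" for x
    using that J[of x] J[of "x \<oplus> \<one>"] assms(4) by (simp add: add_eq[symmetric])
  moreover have "subs M J (rcar R)" "\<zero> \<epsilon> J"
    using J assms(3) by (simp_all add: subs_def mem_rcar)
  ultimately have "n \<epsilon> J" using assms(1) mem_nats by blast
  then show ?thesis by (simp add: J)
qed

text \<open>External induction, where \<open>P\<close> may mention \<open>st\<close>.
  Standardization turns \<open>P\<close> into a standard set \<open>S\<close>; its closure under
  successor is checked at standard elements and transferred, and the minimality of the naturals puts
  \<open>n\<close> into \<open>S\<close>.\<close>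

lemma st_nats_induct:
  assumes "st M n" "n \<epsilon> N" "dfb M False True (\<lambda>e. P (e 0))" "P \<zero>"
    "\<And>n. st M n \<Longrightarrow> n \<epsilon> N \<Longrightarrow> P n \<Longrightarrow> P (n \<oplus> \<one>)"
  shows "P n"
proof -
  obtain S where S: "st M S" "\<And>x. st M x \<Longrightarrow> x \<epsilon> S \<longleftrightarrow> x \<epsilon> N \<and> P x"
    using standardization_dfb[of P N] assms(3) by blast
  have "x \<epsilon> S \<longrightarrow> padd x \<one> \<epsilon> S \<and> x \<epsilon> rcar R" for x
  proof (rule transfer_all[of "\<lambda>x. x \<epsilon> S \<longrightarrow> padd x \<one> \<epsilon> S \<and> x \<epsilon> rcar R"])
    show "dfb M True False (\<lambda>e. e 0 \<epsilon> S \<longrightarrow> padd (e 0) \<one> \<epsilon> S \<and> e 0 \<epsilon> rcar R)"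
      using S by (intro dfb; simp)
  next
    fix x assume "st M x"
    show "x \<epsilon> S \<longrightarrow> padd x \<one> \<epsilon> S \<and> x \<epsilon> rcar R"
    proof
      assume "x \<epsilon> S"
      then have x: "x \<epsilon> N" "P x" using S(2)[OF \<open>st M x\<close>] by simp_all
      then have "x \<oplus> \<one> \<epsilon> S" using S(2)[of "x \<oplus> \<one>"] assms(5) \<open>st M x\<close> by simp
      then show "padd x \<one> \<epsilon> S \<and> x \<epsilon> rcar R"
        using x nats_real[of x] by (simp add: add_eq mem_rcar)
    qed
  qed
  then have "n \<epsilon> S"
    using assms(2,4) S(2)[of \<zero>] mem_nats[of n] by (auto simp: subs_def)
  then show ?thesis using S(2) assms(1) by blast
qed

lemma nats_nonneg: "n \<epsilon> N \<Longrightarrow> \<zero> \<preceq> n"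
proof (erule nats_induct)
  show "dfb M False False (\<lambda>e. \<zero> \<preceq> e 0)" by (intro dfb; simp)
next
  fix n assume "n \<epsilon> N" "\<zero> \<preceq> n"
  then show "\<zero> \<preceq> n \<oplus> \<one>" using less_succ[of n] le_less_trans less_imp_le by (meson nats_real)
qed simp

lemma nats_cases:
  assumes "n \<epsilon> N"
  shows "n = \<zero> \<or> (\<exists>m. m \<epsilon> N \<and> n = m \<oplus> \<one>)"
proof -
  have "n = \<zero> \<or> (\<exists>m. m \<epsilon> N \<and> n = padd m \<one>)"
  proof (rule nats_induct[OF assms, of "\<lambda>n. n = \<zero> \<or> (\<exists>m. m \<epsilon> N \<and> n = padd m \<one>)"])
    show "dfb M False False (\<lambda>e. e 0 = \<zero> \<or> (\<exists>m. m \<epsilon> N \<and> e 0 = padd m \<one>))"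
      by (intro dfb; simp)
  qed (auto simp: add_eq)
  then show ?thesis by (auto simp: add_eq)
qed

text \<open>Induction on \<open>n\<close> for all \<open>j\<close> at once: a nonzero
  \<open>j\<close> has a predecessor, and the induction hypothesis applies to that
  predecessor.\<close>

lemma nats_less_imp_succ_le:
  assumes "n \<epsilon> N" "j \<epsilon> N" "j \<prec> n"
  shows "j \<oplus> \<one> \<preceq> n"
proof -
  have "\<forall>j. j \<epsilon> N \<and> j \<prec> n \<longrightarrow> padd j \<one> \<preceq> n"
  proof (rule nats_induct[OF assms(1), of "\<lambda>n. \<forall>j. j \<epsilon> N \<and> j \<prec> n \<longrightarrow> padd j \<one> \<preceq> n"])
    show "dfb M False False (\<lambda>e. \<forall>j. j \<epsilon> N \<and> j \<prec> e 0 \<longrightarrow> padd j \<one> \<preceq> e 0)"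
      by (intro dfb; simp)
    show "\<forall>j. j \<epsilon> N \<and> j \<prec> \<zero> \<longrightarrow> padd j \<one> \<preceq> \<zero>"
      using nats_nonneg le_less_trans less_irrefl real_0_1 by blast
  next
    fix n assume n: "n \<epsilon> N" and IH: "\<forall>j. j \<epsilon> N \<and> j \<prec> n \<longrightarrow> padd j \<one> \<preceq> n"
    show "\<forall>j. j \<epsilon> N \<and> j \<prec> n \<oplus> \<one> \<longrightarrow> padd j \<one> \<preceq> n \<oplus> \<one>"
    proof (intro allI impI, elim conjE)
      fix j assume j: "j \<epsilon> N" "j \<prec> n \<oplus> \<one>"
      have "j \<preceq> n"
      proof (cases "j = \<zero>")
        case True then show ?thesis using nats_nonneg n by simp
      next
        case False
        then obtain i where i: "i \<epsilon> N" "j = i \<oplus> \<one>" using nats_cases[OF j(1)] by blast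
        then have "i \<prec> n" using j n add_less_iff[of i n \<one>] by simp
        then show ?thesis using IH i by (simp add: add_eq)
      qed
      then show "padd j \<one> \<preceq> n \<oplus> \<one>"
        using add_le[of j n \<one>] j n by (simp add: add_eq[of j, symmetric])
    qed
  qed
  then show ?thesis using assms by (simp add: add_eq)
qed

lemma nats_less_succ_iff:
  assumes "n \<epsilon> N" "j \<epsilon> N"
  shows "j \<prec> n \<oplus> \<one> \<longleftrightarrow> j \<preceq> n"
proof
  assume "j \<prec> n \<oplus> \<one>"
  then have "j \<oplus> \<one> \<preceq> n \<oplus> \<one>" using nats_less_imp_succ_le assms by simp
  then show "j \<preceq> n"
    using add_less_iff[of j n \<one>] add_left_cancel[of j n \<one>] assms by (auto simp: le_r_def)
next
  assume "j \<preceq> n"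
  then show "j \<prec> n \<oplus> \<one>" using less_succ assms le_less_trans nats_real by blast
qed

text \<open>External induction works since the only natural number that is at most n+1 without being
  at most n is n+1 itself. Consequently a nonstandard natural number exceeds every standard
  one.\<close>

lemma st_nats_downward:
  assumes "st M n" "n \<epsilon> N" "k \<epsilon> N" "k \<preceq> n"
  shows "st M k"
proof -
  have "\<forall>k. k \<epsilon> N \<and> k \<preceq> n \<longrightarrow> st M k"
  proof (rule st_nats_induct[OF assms(1,2), of "\<lambda>n. \<forall>k. k \<epsilon> N \<and> k \<preceq> n \<longrightarrow> st M k"])
    show "dfb M False True (\<lambda>e. \<forall>k. k \<epsilon> N \<and> k \<preceq> e 0 \<longrightarrow> st M k)"
      by (intro dfb; simp)
    show "\<forall>k. k \<epsilon> N \<and> k \<preceq> \<zero> \<longrightarrow> st M k"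
      using nats_nonneg less_asym unfolding le_r_def by (metis st_components(4))
  next
    fix n assume n: "st M n" "n \<epsilon> N" "\<forall>k. k \<epsilon> N \<and> k \<preceq> n \<longrightarrow> st M k"
    show "\<forall>k. k \<epsilon> N \<and> k \<preceq> n \<oplus> \<one> \<longrightarrow> st M k"
    proof (intro allI impI, elim conjE)
      fix k assume k: "k \<epsilon> N" "k \<preceq> n \<oplus> \<one>"
      show "st M k"
      proof (cases "k = n \<oplus> \<one>")
        case True then show ?thesis using n by simp
      next
        case False
        then have "k \<prec> n \<oplus> \<one>" using k by (simp add: le_r_def)
        then show ?thesis using nats_less_succ_iff n k by blast
      qed
    qed
  qed
  then show ?thesis using assms by blast
qed

lemma archimedean:
  assumes "Re b" obtains n where "n \<epsilon> N" "b \<prec> n"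
proof -
  have "\<exists>n. n \<epsilon> N \<and> b \<prec> n"
  proof (rule ccontr)
    assume "\<not> ?thesis"
    then have "\<And>n. n \<epsilon> N \<Longrightarrow> n \<preceq> b" using assms not_less by simp
    moreover have "subs M N (rcar R)"
      using nats_real by (auto simp: subs_def mem_rcar)
    ultimately obtain s where s: "Re s" "\<And>n. n \<epsilon> N \<Longrightarrow> n \<preceq> s"
      "\<And>b. Re b \<Longrightarrow> (\<And>n. n \<epsilon> N \<Longrightarrow> n \<preceq> b) \<Longrightarrow> s \<preceq> b"
      using ex_sup[of N \<zero> b] assms by auto
    \<comment> \<open>As the naturals are closed under successor, s-1 bounds them as well, although
      \<open>s\<close> is the least bound.\<close>
    have "n \<preceq> s \<oplus> \<ominus> \<one>" if "n \<epsilon> N" for n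
      using add_le[of "n \<oplus> \<one>" s "\<ominus> \<one>"] s that by (simp add: add_neg_cancel)
    then have "s \<preceq> s \<oplus> \<ominus> \<one>" using s by simp
    then have "s \<oplus> \<one> \<preceq> s" using add_le[of s "s \<oplus> \<ominus> \<one>" \<one>] s by (simp add: add_neg_cancel)
    then show False using less_succ[of s] s(1) less_le_trans less_irrefl by blast
  qed
  then show ?thesis using that by blast
qed

lemma st_archimedean:
  assumes "Re b" "st M b" obtains n where "st M n" "n \<epsilon> N" "b \<prec> n"
proof -
  have "dfb M True False (\<lambda>e. e 0 \<epsilon> N \<and> b \<prec> e 0)"
    using assms by (intro dfb; simp)
  moreover obtain n where "n \<epsilon> N \<and> b \<prec> n"
    using archimedean[OF assms(1)] by blast
  ultimately obtain n where "st M n" "n \<epsilon> N \<and> b \<prec> n"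
    using transfer_ex[of "\<lambda>n. n \<epsilon> N \<and> b \<prec> n" n] by blast
  then show ?thesis using that by blast
qed

subsection \<open>Shadows\<close>

lemma inverse:
  assumes "\<zero> \<prec> x" shows "Re (inverse_r M R x)" "x \<otimes> inverse_r M R x = \<one>" "\<zero> \<prec> inverse_r M R x"
    "st M x \<Longrightarrow> st M (inverse_r M R x)"
proof -
  have x: "Re x" "x \<noteq> \<zero>" using assms less_real less_irrefl[of \<zero>] by auto
  obtain y where y: "Re y" "x \<otimes> y = \<one>" using ex_inverse[OF x] by blast
  have uniq: "z = y" if z: "Re z" "x \<otimes> z = \<one>" for z
    using mult_assoc[of z x y] x y z mult_comm[of z x] mult_comm[of z \<one>] by simp
  have eq: "inverse_r M R x = y"
    unfolding inverse_r_def by (rule the_equality) (use y uniq in blast)+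
  show "Re (inverse_r M R x)" "x \<otimes> inverse_r M R x = \<one>" using y eq by simp_all
  have "\<not> y \<prec> \<zero>"
  proof
    assume "y \<prec> \<zero>"
    then have "y \<otimes> x \<prec> \<zero> \<otimes> x" using mult_less[of y \<zero> x] assms x y by simp
    then show False using x y mult_comm[of y x] zero_less_one less_asym by simp
  qed
  moreover have "y \<noteq> \<zero>" using y x zero_neq_one mult_comm[of x \<zero>] by auto
  ultimately show "\<zero> \<prec> inverse_r M R x" using linear[of y \<zero>] y eq by auto
  assume "st M x"
  show "st M (inverse_r M R x)" unfolding eq
  proof (rule st_unique[of "\<lambda>y. Re y \<and> pmul x y = \<one>"])
    show "dfb M True False (\<lambda>e. Re (e 0) \<and> pmul x (e 0) = \<one>)"
      using \<open>st M x\<close> by (intro dfb; simp)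
    show "Re y \<and> pmul x y = \<one>" using x y by (simp add: mul_eq)
    fix z assume "Re z \<and> pmul x z = \<one>"
    then show "z = y" using uniq[of z] x by (simp add: mul_eq)
  qed
qed

text \<open>Arbitrary standard positive bounds stand in for the reciprocals 1/n that occur in
  \<open>sh\<close>, because such bounds can be halved and added.\<close>

definition near :: "'a \<Rightarrow> 'a \<Rightarrow> bool" where
  "near r s \<longleftrightarrow> (\<forall>e. st M e \<and> \<zero> \<prec> e \<longrightarrow> r \<prec> s \<oplus> e \<and> s \<prec> r \<oplus> e)"

text \<open>Neither family of bounds is finer than the other: 1/n is standard and positive for
  standard n, and below a standard positive \<open>e\<close> lies 1/n for every standard n > 1/e,
  which exists by the Archimedean property.\<close>

lemma near_iff:
  assumes "Re r" "Re s"
  shows "near r s \<longleftrightarrow> (\<forall>n. st M n \<and> n \<epsilon> N \<and> \<one> \<preceq> n \<longrightarrow> abs_r M R (r \<oplus> \<ominus> s) \<prec> inverse_r M R n)"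
    (is "_ \<longleftrightarrow> ?Q")
proof
  assume *: "near r s"
  show ?Q
  proof (intro allI impI, elim conjE)
    fix n assume n: "st M n" "n \<epsilon> N" "\<one> \<preceq> n"
    then have "\<zero> \<prec> n" using zero_less_one less_le_trans by blast
    then show "abs_r M R (r \<oplus> \<ominus> s) \<prec> inverse_r M R n"
      using * inverse[of n] n assms unfolding near_def by (subst abs_diff_less_iff) blast+
  qed
next
  assume Q: ?Q
  show "near r s" unfolding near_def
  proof (intro allI impI, elim conjE)
    fix e assume e: "st M e" "\<zero> \<prec> e"
    note re = less_real(2)[OF e(2)]
    note i = inverse[OF e(2)]
    obtain n where n: "st M n" "n \<epsilon> N" "inverse_r M R e \<prec> n"
      using st_archimedean[OF i(1) i(4)[OF e(1)]] .
    have n0: "\<zero> \<prec> n" using less_trans[OF _ _ _ i(3) n(3)] i(1) n(2) by simp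
    note j = inverse[OF n0]
    have "\<one> \<preceq> n" using nats_less_imp_succ_le[OF n(2) zero_nats n0] by simp
    then have a: "abs_r M R (r \<oplus> \<ominus> s) \<prec> inverse_r M R n" using Q n by blast
    have "inverse_r M R n \<prec> e"
    proof (rule ccontr)
      assume "\<not> ?thesis"
      then have "e \<preceq> inverse_r M R n" using not_less j(1) re by simp
      then have "e \<otimes> n \<preceq> inverse_r M R n \<otimes> n"
        unfolding le_r_def using mult_less[OF _ _ _ _ n0] re j(1) n(2) by auto
      then have 1: "e \<otimes> n \<preceq> \<one>" using mult_comm[of n] j n(2) by simp
      have "inverse_r M R e \<otimes> e \<prec> n \<otimes> e" using mult_less[OF _ _ _ n(3) e(2)] i(1) n(2) re by simp
      then have "\<one> \<prec> e \<otimes> n" using mult_comm[of e] i n(2) re by simp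
      then show False using 1 less_le_trans less_irrefl real_0_1 by blast
    qed
    then have "abs_r M R (r \<oplus> \<ominus> s) \<prec> e" using a less_trans less_real by meson
    then show "r \<prec> s \<oplus> e \<and> s \<prec> r \<oplus> e" using abs_diff_less_iff assms e by simp
  qed
qed

text \<open>With h half of the standard gap t - s, nearness would give t < r + h < s + 2h =
  t.\<close>

lemma near_not_less:
  assumes "Re r" "st M s" "st M t" "near r s" "near r t"
  shows "\<not> s \<prec> t"
proof
  assume *: "s \<prec> t"
  note re = less_real[OF *]
  have "\<zero> \<prec> t \<oplus> \<ominus> s" using add_less[OF _ _ _ *, of "\<ominus> s"] re by simp
  moreover have "st M (t \<oplus> \<ominus> s)" using re assms by simp
  ultimately obtain h where h: "\<zero> \<prec> h" "st M h" "h \<oplus> h = t \<oplus> \<ominus> s"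
    by (rule st_half)
  have rh: "Re h" using h less_real by blast
  have "t \<prec> r \<oplus> h" "r \<prec> s \<oplus> h" using assms h by (auto simp: near_def)
  then have "t \<prec> (s \<oplus> h) \<oplus> h"
    using add_less[of r "s \<oplus> h" h] less_trans[of t "r \<oplus> h" "(s \<oplus> h) \<oplus> h"] re rh assms(1) by simp
  also have "(s \<oplus> h) \<oplus> h = t"
    using re rh h(3) add_left_comm[of s t "\<ominus> s"] by (simp add: add_assoc)
  finally show False using re by simp
qed

lemma near_unique:
  "Re r \<Longrightarrow> Re s \<Longrightarrow> Re t \<Longrightarrow> st M s \<Longrightarrow> st M t \<Longrightarrow> near r s \<Longrightarrow> near r t \<Longrightarrow> s = t"
  using near_not_less linear by metis

lemma near_add:
  assumes "Re a" "Re b" "Re s" "Re t" "near a s" "near b t"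
  shows "near (a \<oplus> b) (s \<oplus> t)"
  unfolding near_def
proof (intro allI impI, elim conjE)
  fix e assume "st M e" "\<zero> \<prec> e"
  then obtain h where h: "\<zero> \<prec> h" "st M h" "h \<oplus> h = e" using st_half by blast
  have rh: "Re h" using h less_real by blast
  have sw: "(x \<oplus> h) \<oplus> (y \<oplus> h) = (x \<oplus> y) \<oplus> e" if "Re x" "Re y" for x y
    using that rh h(3)[symmetric] by (simp add: add_assoc) (simp add: add_left_comm)
  show "a \<oplus> b \<prec> s \<oplus> t \<oplus> e \<and> s \<oplus> t \<prec> a \<oplus> b \<oplus> e"
    using assms(5,6) h add_less_mono unfolding near_def sw[symmetric, OF assms(1,2)] sw[symmetric, OF assms(3,4)]
    by blast
qed

text \<open>The shadow is the supremum of the standard set \<open>S\<close> whose standard elements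
  are the standard reals up to \<open>r\<close>. By transfer this supremum can be taken
  standard.\<close>

lemma ex_shadow:
  assumes r: "Re r" "\<zero> \<preceq> r" and b: "st M b" "r \<prec> b"
  shows "\<exists>s. st M s \<and> Re s \<and> near r s"
proof -
  have "dfb M False True (\<lambda>e. e 0 \<preceq> r)" by (intro dfb; simp)
  then obtain S where S: "st M S" "\<And>x. st M x \<Longrightarrow> x \<epsilon> S \<longleftrightarrow> x \<epsilon> rcar R \<and> x \<preceq> r"
    using standardization_dfb[of "\<lambda>x. x \<preceq> r" "rcar R"] by blast
  \<comment> \<open>Nonstandard elements of \<open>S\<close> need not be at most \<open>r\<close>,
    but by transfer every standard bound of \<open>r\<close> also bounds them.\<close>
  have ub: "x \<epsilon> S \<longrightarrow> x \<preceq> c" if c: "st M c" "r \<preceq> c" for c x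
    by (rule transfer_all[of "\<lambda>x. x \<epsilon> S \<longrightarrow> x \<preceq> c"])
      (use S c le_trans in \<open>auto intro!: dfb\<close>)
  have "subs M S (rcar R)"
    using st_subs[OF S(1) st_components(1)] S(2) by (auto simp: subs_def)
  moreover have "\<zero> \<epsilon> S" using S(2)[of \<zero>] r by (simp add: mem_rcar)
  moreover have "Re b" using b less_real by blast
  moreover have "x \<epsilon> S \<Longrightarrow> x \<preceq> b" for x using ub[of b] b less_imp_le by blast
  ultimately have "\<exists>s. Re s \<and> (\<forall>x. x \<epsilon> S \<longrightarrow> x \<preceq> s) \<and>
      (\<forall>b. Re b \<and> (\<forall>x. x \<epsilon> S \<longrightarrow> x \<preceq> b) \<longrightarrow> s \<preceq> b)" (is "\<exists>s. ?sup s")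
    by (rule ex_sup)
  moreover have "dfb M True False (\<lambda>e. ?sup (e 0))"
    using S(1) by (intro dfb; simp)
  ultimately obtain s where s': "st M s" "?sup s"
    using transfer_ex[of ?sup] by blast
  then have s: "st M s" "Re s" "\<And>x. x \<epsilon> S \<Longrightarrow> x \<preceq> s"
      "\<And>b. Re b \<Longrightarrow> (\<And>x. x \<epsilon> S \<Longrightarrow> x \<preceq> b) \<Longrightarrow> s \<preceq> b"
    by blast+
  have "near r s" unfolding near_def
  proof (intro allI impI conjI, elim conjE)
    fix e assume e: "st M e" "\<zero> \<prec> e"
    then have re: "Re e" using less_real by blast
    show "r \<prec> s \<oplus> e"
    proof (rule ccontr)
      assume "\<not> ?thesis"
      \<comment> \<open>Otherwise s+e is a standard real up to \<open>r\<close>, hence an element of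
        \<open>S\<close> above its supremum.\<close>
      then have "s \<oplus> e \<epsilon> S" using S(2)[of "s \<oplus> e"] re s e r not_less by (simp add: mem_rcar)
      then show False using less_le_trans[OF less_add_pos[OF s(2) e(2)] s(3)] s(2) by simp
    qed
  next
    fix e assume "st M e \<and> \<zero> \<prec> e"
    then have e: "st M e" "\<zero> \<prec> e" and re: "Re e" using less_real by blast+
    show "s \<prec> r \<oplus> e"
    proof (rule ccontr)
      assume "\<not> ?thesis"
      then have "r \<oplus> e \<preceq> s" using re s r not_less by simp
      then have "r \<preceq> s \<oplus> \<ominus> e" using add_le[of "r \<oplus> e" s "\<ominus> e"] re s r by (simp add: add_neg_cancel)
      \<comment> \<open>Here s-e is a standard bound of \<open>r\<close>, so it bounds
        \<open>S\<close> and contradicts the minimality of \<open>s\<close>.\<close>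
      then have "x \<preceq> s \<oplus> \<ominus> e" if "x \<epsilon> S" for x
        using ub[of "s \<oplus> \<ominus> e"] s(1,2) re e that by simp
      then have "s \<preceq> s \<oplus> \<ominus> e" using s(2,4) re by simp
      then have "s \<oplus> e \<preceq> s" using add_le[of s "s \<oplus> \<ominus> e" e] s(2) re by (simp add: add_neg_cancel)
      then show False using less_le_trans[OF less_add_pos[OF s(2) e(2)], of s] s(2) by simp
    qed
  qed
  then show ?thesis using s by blast
qed

lemma limited_iff:
  assumes "Re r" "\<zero> \<preceq> r"
  shows "limited M R r \<longleftrightarrow> (\<exists>b. st M b \<and> r \<prec> b)"
proof -
  have "abs_r M R r = r" using assms not_less[of r \<zero>] by (simp add: abs_r_def)
  then have "limited M R r \<longleftrightarrow> (\<exists>n. st M n \<and> n \<epsilon> N \<and> r \<prec> n)" using assms by (simp add: limited_def)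
  also have "\<dots> \<longleftrightarrow> (\<exists>b. st M b \<and> r \<prec> b)"
    using st_archimedean less_trans less_real by metis
  finally show ?thesis .
qed

lemma sh_eqI:
  assumes "Re r" "\<zero> \<preceq> r" "limited M R r" "st M s" "Re s" "near r s"
  shows "sh M R r = s"
proof -
  have "sh M R r = (THE s. st M s \<and> Re s \<and> near r s)"
    using assms(1,3) unfolding sh_def by (auto simp: near_iff cong: conj_cong)
  also have "\<dots> = s"
    by (rule the_equality) (use assms near_unique in blast)+
  finally show ?thesis .
qed

lemma sh_limited:
  assumes "Re r" "\<zero> \<preceq> r" "limited M R r"
  shows "st M (sh M R r)" "Re (sh M R r)" "near r (sh M R r)"
proof -
  obtain s where "st M s" "Re s" "near r s"
    using ex_shadow limited_iff assms by blast
  then show "st M (sh M R r)" "Re (sh M R r)" "near r (sh M R r)"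
    using sh_eqI[OF assms, of s] by simp_all
qed

lemma sh_unlimited: "\<not> limited M R r \<Longrightarrow> sh M R r = rinf R"
  by (simp add: sh_def)

section \<open>The extended half-line and additivity of the shadow\<close>

lemma mem_ext_nonneg: "x \<epsilon> ext_nonneg M R \<longleftrightarrow> Re x \<and> \<zero> \<preceq> x \<or> x = rinf R"
  unfolding ext_nonneg_def
proof (rule mem_setof)
  have "\<exists>z. \<forall>t. t \<epsilon> z \<longleftrightarrow> t \<epsilon> union M (rcar R) (upair M (rinf R) (rinf R)) \<and>
    (Re t \<and> \<zero> \<preceq> t \<or> t = rinf R)"
    by (rule separation_dfb) (intro dfb; simp)
  then show "\<exists>z. \<forall>t. t \<epsilon> z \<longleftrightarrow> Re t \<and> \<zero> \<preceq> t \<or> t = rinf R"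
    by (simp add: mem_rcar) metis
qed

lemma limited_add_iff:
  assumes "Re a" "\<zero> \<preceq> a" "Re b" "\<zero> \<preceq> b"
  shows "limited M R (a \<oplus> b) \<longleftrightarrow> limited M R a \<and> limited M R b"
proof -
  have le: "a \<preceq> a \<oplus> b" "b \<preceq> a \<oplus> b"
    using le_add_nonneg[of a b] le_add_nonneg[of b a] assms by (simp_all add: add_comm)
  have "\<zero> \<preceq> a \<oplus> b" using le_trans assms le by blast
  moreover have "\<exists>c. st M c \<and> a \<oplus> b \<prec> c" if "st M c" "a \<prec> c" "st M d" "b \<prec> d" for c d
    using add_less_mono[OF that(2,4)] that less_real by (meson st_add)
  ultimately show ?thesis
    using limited_iff assms le le_less_trans by (metis add_closed)
qed

text \<open>The source of the finite additivity of \<open>m\<close>. Shadows of limited summands add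
  by \<open>near_add\<close>; if a summand is not limited, nonnegativity prevents cancellation, and
  both sides are infinite.\<close>

lemma sh_plus:
  assumes "a \<epsilon> ext_nonneg M R" "b \<epsilon> ext_nonneg M R"
  shows "sh M R (plus_x M R a b) = plus_x M R (sh M R a) (sh M R b)"
proof (cases "limited M R a \<and> limited M R b")
  case True
  then have r: "Re a" "\<zero> \<preceq> a" "Re b" "\<zero> \<preceq> b"
    using assms by (auto simp: mem_ext_nonneg limited_def)
  note l = sh_limited[OF r(1,2)] sh_limited[OF r(3,4)]
  have "\<zero> \<preceq> a \<oplus> b" using le_add_nonneg r le_trans by blast
  then have "sh M R (a \<oplus> b) = sh M R a \<oplus> sh M R b"
    using True l r by (intro sh_eqI near_add) (simp_all add: limited_add_iff)
  then show ?thesis using r l True by (simp add: plus_x_def)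
next
  case False
  have "\<not> limited M R (plus_x M R a b)"
  proof (cases "Re a \<and> Re b")
    case True
    then have "\<zero> \<preceq> a" "\<zero> \<preceq> b" using assms by (auto simp: mem_ext_nonneg)
    then show ?thesis using False True limited_add_iff by (simp add: plus_x_def)
  next
    case False
    then show ?thesis by (auto simp: plus_x_def limited_def)
  qed
  then show ?thesis
    using False by (auto simp: sh_unlimited plus_x_def)
qed

lemma sh_0 [simp]: "sh M R \<zero> = \<zero>"
proof (rule sh_eqI)
  show "limited M R \<zero>"
    using limited_iff[of \<zero>] zero_less_one st_components(5) by auto
qed (auto simp: near_def less_real)

lemma deft_plus_x [dfb]:
  assumes "deft M s b t" "deft M s b u"
  shows "deft M s b (\<lambda>e. plus_x M R (t e) (u e))"
proof (rule deft_fun2[OF _ assms])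
  have *: "z = plus_x M R x y \<longleftrightarrow> Re x \<and> Re y \<and> z = padd x y \<or> \<not> (Re x \<and> Re y) \<and> z = rinf R" for x y z
    by (auto simp: plus_x_def add_eq)
  show "dfb M s b (\<lambda>e. e 0 = plus_x M R (e (Suc 0)) (e (Suc (Suc 0))))"
    unfolding * by (intro dfb; simp)
qed

lemma tends_x_eventually_const:
  assumes "l \<epsilon> ext_nonneg M R" "n \<epsilon> N" "\<And>k. k \<epsilon> N \<Longrightarrow> n \<preceq> k \<Longrightarrow> app M p k = l"
  shows "tends_x M R p l"
  unfolding tends_x_def using assms by metis

end

section \<open>The quotient and its algebra\<close>

locale germs = BST_reals +
  fixes Os I w
  assumes st_Os [simp]: "st M Os" and st_I [simp]: "st M I" and w: "w \<epsilon> I"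
begin

abbreviation FS where "FS \<equiv> funspace M I Os"
abbreviation Q where "Q \<equiv> quot M I Os w"
abbreviation "gm \<equiv> germ M I Os w"
abbreviation "br \<equiv> brack M I Os w"

lemma st_set_cong: "(\<And>x. x \<epsilon> A \<Longrightarrow> P x \<longleftrightarrow> P' x) \<Longrightarrow> st_set M A P = st_set M A P'"
  unfolding st_set_def by (simp cong: conj_cong)

lemma app_w: "f \<epsilon> FS \<Longrightarrow> app M f w = ap f w"
  using maps_ap w by simp

lemma germ:
  assumes "f \<epsilon> FS"
  shows "st M (gm f)" "st M g \<Longrightarrow> g \<epsilon> gm f \<longleftrightarrow> g \<epsilon> FS \<and> ap g w = ap f w"
proof -
  have "gm f = st_set M FS (\<lambda>g. ap g w = ap f w)"
    unfolding germ_def by (rule st_set_cong) (simp only: app_w assms)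
  moreover have "dfb M False True (\<lambda>e. ap (e 0) w = ap f w)"
    by (intro dfb; simp)
  ultimately show "st M (gm f)" "st M g \<Longrightarrow> g \<epsilon> gm f \<longleftrightarrow> g \<epsilon> FS \<and> ap g w = ap f w"
    using st_set[of "\<lambda>g. ap g w = ap f w"] by simp_all
qed

text \<open>\<open>germ\<close> is a definite description. Written out in this way, the equation
  becomes a condition in membership and \<open>st\<close> to which the closure rules apply.\<close>

lemma eq_germ_iff:
  "f \<epsilon> FS \<Longrightarrow> c = gm f \<longleftrightarrow> st M c \<and> (\<forall>g. st M g \<longrightarrow> (g \<epsilon> c \<longleftrightarrow> g \<epsilon> FS \<and> ap g w = ap f w))"
proof
  assume f: "f \<epsilon> FS" and "c = gm f"
  then show "st M c \<and> (\<forall>g. st M g \<longrightarrow> (g \<epsilon> c \<longleftrightarrow> g \<epsilon> FS \<and> ap g w = ap f w))"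
    using germ[OF f] by blast
next
  assume f: "f \<epsilon> FS" and c: "st M c \<and> (\<forall>g. st M g \<longrightarrow> (g \<epsilon> c \<longleftrightarrow> g \<epsilon> FS \<and> ap g w = ap f w))"
  show "c = gm f"
    by (rule st_ext) (use c germ[OF f] in blast)+
qed

text \<open>Being standard, \<open>f\<close> is a standard element of its own germ, so it can be
  tested for membership in the germ of \<open>g\<close>.\<close>

lemma germ_eq_iff: "f \<epsilon> FS \<Longrightarrow> g \<epsilon> FS \<Longrightarrow> st M f \<Longrightarrow> gm f = gm g \<longleftrightarrow> ap f w = ap g w"
  using germ(2)[of g f] germ(2)[of f f] eq_germ_iff[of g "gm f"] germ[of f] by (metis (no_types))

lemma germ_ex_cong:
  "(\<exists>f. st M f \<and> f \<epsilon> FS \<and> c = gm f) \<longleftrightarrow> (\<exists>f. st M f \<and> f \<epsilon> FS \<and>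
    st M c \<and> (\<forall>g. st M g \<longrightarrow> (g \<epsilon> c \<longleftrightarrow> g \<epsilon> FS \<and> ap g w = ap f w)))"
  "(\<exists>f. st M f \<and> f \<epsilon> FS \<and> app M f w \<epsilon> X \<and> c = gm f) \<longleftrightarrow> (\<exists>f. st M f \<and> f \<epsilon> FS \<and> ap f w \<epsilon> X \<and>
    st M c \<and> (\<forall>g. st M g \<longrightarrow> (g \<epsilon> c \<longleftrightarrow> g \<epsilon> FS \<and> ap g w = ap f w)))"
  by (simp_all add: eq_germ_iff app_w cong: conj_cong)

lemma quot: "st M Q" "st M c \<Longrightarrow> c \<epsilon> Q \<longleftrightarrow> (\<exists>f. st M f \<and> f \<epsilon> FS \<and> c = gm f)"
proof -
  let ?P = "\<lambda>c. \<exists>f. st M f \<and> f \<epsilon> FS \<and> c = gm f"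
  have "dfb M False True (\<lambda>e. ?P (e 0))"
    unfolding germ_ex_cong by (intro dfb; simp)
  note * = st_set[where P = ?P and A = "powset M FS", OF this, folded quot_def]
  show "st M Q" by (rule *)
  assume c: "st M c"
  have "subs M (gm f) FS" if "f \<epsilon> FS" for f
    using st_subs[of "gm f" FS] germ[OF that] by (simp add: subs_def)
  then show "c \<epsilon> Q \<longleftrightarrow> ?P c" using *(2)[OF c] by auto
qed

lemma brack: "st M (br X)"
  "st M c \<Longrightarrow> c \<epsilon> br X \<longleftrightarrow> (\<exists>f. st M f \<and> f \<epsilon> FS \<and> ap f w \<epsilon> X \<and> c = gm f)"
proof -
  let ?P = "\<lambda>c. \<exists>f. st M f \<and> f \<epsilon> FS \<and> app M f w \<epsilon> X \<and> c = gm f"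
  have "dfb M False True (\<lambda>e. ?P (e 0))"
    unfolding germ_ex_cong by (intro dfb; simp)
  note * = st_set[where P = ?P and A = Q, OF this, folded brack_def]
  show "st M (br X)" by (rule *)
  assume c: "st M c"
  have "c \<epsilon> br X \<longleftrightarrow> ?P c" using *(2)[OF c] quot(2)[OF c] by blast
  also have "\<dots> \<longleftrightarrow> (\<exists>f. st M f \<and> f \<epsilon> FS \<and> ap f w \<epsilon> X \<and> c = gm f)"
    by (simp add: app_w cong: conj_cong)
  finally show "c \<epsilon> br X \<longleftrightarrow> (\<exists>f. st M f \<and> f \<epsilon> FS \<and> ap f w \<epsilon> X \<and> c = gm f)" .
qed

text \<open>The choice of representative does not matter, since germs of standard functions coincide
  exactly when the values at \<open>w\<close> do. This lets set operations on brackets be computed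
  at \<open>w\<close>.\<close>

lemma germ_mem_brack: "st M f \<Longrightarrow> f \<epsilon> FS \<Longrightarrow> gm f \<epsilon> br X \<longleftrightarrow> ap f w \<epsilon> X"
  using brack(2)[of "gm f" X] germ(1)[of f] germ_eq_iff by metis

lemma brack_eqI:
  assumes "st M A" "subs M A Q" "\<And>f. st M f \<Longrightarrow> f \<epsilon> FS \<Longrightarrow> gm f \<epsilon> A \<longleftrightarrow> ap f w \<epsilon> X"
  shows "A = br X"
proof (rule st_ext[OF assms(1) brack(1)])
  fix c assume c: "st M c"
  have "c \<epsilon> A \<Longrightarrow> c \<epsilon> Q" using assms(2) by (simp add: subs_def)
  then show "c \<epsilon> A \<longleftrightarrow> c \<epsilon> br X"
    using quot(2)[OF c] brack(2)[OF c] germ_mem_brack assms(3) by metis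
qed

lemma brack_subs: "subs M (br X) Q"
  using st_subs[OF brack(1) quot(1)] brack(2) quot(2) by (auto simp: subs_def)

lemma deft_brack [dfb]:
  assumes "deft M False True t" shows "deft M False True (\<lambda>e. br (t e))"
proof (rule deft_fun1[OF _ assms])
  have *: "A = br X \<longleftrightarrow> st M A \<and> (\<forall>c. st M c \<longrightarrow> (c \<epsilon> A \<longleftrightarrow>
      (\<exists>f. st M f \<and> f \<epsilon> FS \<and> app M f w \<epsilon> X \<and> c = gm f)))" for A X
  proof -
    have "A = br X \<longleftrightarrow> st M A \<and> (\<forall>c. st M c \<longrightarrow> (c \<epsilon> A \<longleftrightarrow> c \<epsilon> br X))"
      using st_ext[of A "br X"] brack(1)[of X] by blast
    then show ?thesis by (simp add: brack(2) app_w cong: conj_cong)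
  qed
  show "dfb M False True (\<lambda>e. e 0 = br (e (Suc 0)))"
    unfolding * germ_ex_cong by (intro dfb; simp)
qed

section \<open>Sets represented by standard functions\<close>

lemma w_standard_ap: "st M f \<Longrightarrow> maps M f I C \<Longrightarrow> w_standard M I w (ap f w)"
  unfolding w_standard_def using app_eq_ap w by (auto simp: maps_iff)

lemma w_standard_iff: "w_standard M I w x \<longleftrightarrow> (\<exists>f. st M f \<and> func_on M f I \<and> x = ap f w)"
  unfolding w_standard_def using app_eq_ap w by metis

text \<open>A function representing \<open>X\<close> may take arbitrary values away from
  \<open>w\<close>. Intersecting all its values with \<open>Os\<close> brings them into the power
  set and leaves the value at \<open>w\<close> unchanged.\<close>

lemma w_standard_subset:
  assumes "w_standard M I w X" "subs M X Os"
  obtains F where "st M F" "maps M F I (powset M Os)" "X = ap F w"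
proof -
  obtain f where f: "st M f" "func_on M f I" "X = ap f w"
    using assms(1) by (auto simp: w_standard_iff)
  have d: "dfb M True False (\<lambda>e. \<forall>t. t \<epsilon> e (Suc 0) \<longleftrightarrow> t \<epsilon> ap f (e 0) \<and> t \<epsilon> Os)"
    using f(1) by (intro dfb; simp)
  have "\<exists>y. y \<epsilon> powset M Os \<and> (\<forall>t. t \<epsilon> y \<longleftrightarrow> t \<epsilon> ap f v \<and> t \<epsilon> Os)" for v
  proof -
    have "\<exists>y. \<forall>t. t \<epsilon> y \<longleftrightarrow> t \<epsilon> Os \<and> t \<epsilon> ap f v" by (rule separation_dfb) (intro dfb; simp)
    then show ?thesis by (auto simp: subs_def)
  qed
  then obtain F where F: "st M F" "maps M F I (powset M Os)"
    "\<And>v. v \<epsilon> I \<Longrightarrow> \<forall>t. t \<epsilon> ap F v \<longleftrightarrow> t \<epsilon> ap f v \<and> t \<epsilon> Os"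
    using ex_st_function[where P = "\<lambda>v y. \<forall>t. t \<epsilon> y \<longleftrightarrow> t \<epsilon> ap f v \<and> t \<epsilon> Os" and D = I and C = "powset M Os", OF d]
    by auto
  have "X = ap F w"
    using F(3)[OF w] assms(2) f(3) by (auto simp: subs_def intro!: extensionality)
  then show ?thesis using F that by blast
qed

text \<open>The only instance of Los's theorem that is needed.\<close>

lemma ex_w_standard_in_Int:
  assumes "st M F" "st M G" "t \<epsilon> ap F w" "t \<epsilon> ap G w" "t \<epsilon> Os"
  obtains g where "st M g" "g \<epsilon> FS" "ap g w \<epsilon> ap F w" "ap g w \<epsilon> ap G w"
proof -
  let ?P = "\<lambda>v y. (\<exists>t. t \<epsilon> Os \<and> t \<epsilon> ap F v \<and> t \<epsilon> ap G v) \<longrightarrow> y \<epsilon> ap F v \<and> y \<epsilon> ap G v"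
  have d: "dfb M True False (\<lambda>e. ?P (e 0) (e (Suc 0)))"
    using assms by (intro dfb; simp)
  \<comment> \<open>Over indices where the intersection is empty the condition is void, and the
    given \<open>t\<close> serves as a default.\<close>
  have "\<exists>y. y \<epsilon> Os \<and> ?P v y" for v using assms(5) by blast
  then obtain g where g: "st M g" "maps M g I Os" "\<And>v. v \<epsilon> I \<Longrightarrow> ?P v (ap g v)"
    using ex_st_function[where P = ?P and D = I and C = Os, OF d] by auto
  have "ap g w \<epsilon> ap F w \<and> ap g w \<epsilon> ap G w"
    using g(3)[OF w] assms by blast
  then show ?thesis using that g by simp
qed

end

locale loeb = germs +
  fixes \<A>
  assumes subs_Os: "X \<epsilon> \<A> \<Longrightarrow> subs M X Os"
begin

abbreviation "\<B> \<equiv> loeb_algebra M I Os w \<A>"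

lemma loeb_algebra: "st M \<B>"
  "st M A \<Longrightarrow> A \<epsilon> \<B> \<longleftrightarrow> (\<exists>X. X \<epsilon> \<A> \<and> w_standard M I w X \<and> A = br X)"
proof -
  let ?P = "\<lambda>A. \<exists>X. X \<epsilon> \<A> \<and> w_standard M I w X \<and> A = br X"
  have "dfb M False True (\<lambda>e. ?P (e 0))"
    unfolding w_standard_iff by (intro dfb; simp)
  note * = st_set[where P = ?P and A = "powset M Q", OF this, folded loeb_algebra_def]
  show "st M \<B>" by (rule *)
  assume "st M A"
  then show "A \<epsilon> \<B> \<longleftrightarrow> ?P A" using *(2)[of A] brack_subs by auto
qed

lemma loeb_algebra_rep:
  assumes "st M A" "A \<epsilon> \<B>"
  obtains F where "st M F" "maps M F I (powset M Os)" "ap F w \<epsilon> \<A>" "A = br (ap F w)"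
proof -
  obtain X where X: "X \<epsilon> \<A>" "w_standard M I w X" "A = br X"
    using loeb_algebra(2) assms by blast
  then show ?thesis using w_standard_subset[OF X(2) subs_Os[OF X(1)]] that by blast
qed

end

section \<open>Finite additivity of the standard measure\<close>

locale loeb_measure = loeb M R Os I w \<A> for M :: "'a set_structure" (structure) and R Os I w \<A> +
  fixes \<Omega> \<mu> m
  assumes space: "fin_add_measure_space M R \<Omega> \<A> \<mu>"
    and loeb: "is_loeb_measure M R I Os w \<A> \<mu> m"
begin

lemma st_m [simp]: "st M m" and st_B [simp]: "st M \<B>"
  and m_maps: "maps M m \<B> (ext_nonneg M R)"
  using loeb loeb_algebra(1) unfolding is_loeb_measure_def by blast+

lemma m_eq:
  assumes "X \<epsilon> \<A>" "w_standard M I w X"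
  shows "br X \<epsilon> \<B> \<and> ap m (br X) = sh M R (app M \<mu> X)"
proof -
  have B: "br X \<epsilon> \<B>" using loeb_algebra(2)[OF brack(1)] assms by blast
  then have "app M m (br X) = sh M R (app M \<mu> X)"
    using loeb assms brack(1) unfolding is_loeb_measure_def by blast
  then show ?thesis using B maps_ap(1)[OF m_maps B] by simp
qed

lemma union_A: "X \<epsilon> \<A> \<Longrightarrow> Y \<epsilon> \<A> \<Longrightarrow> union M X Y \<epsilon> \<A>"
  and emp_A: "emp M \<epsilon> \<A>"
  and mu_ext: "X \<epsilon> \<A> \<Longrightarrow> app M \<mu> X \<epsilon> ext_nonneg M R"
  and mu_emp: "app M \<mu> (emp M) = \<zero>"
  and mu_union: "X \<epsilon> \<A> \<Longrightarrow> Y \<epsilon> \<A> \<Longrightarrow> disjoint M X Y \<Longrightarrow>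
    app M \<mu> (union M X Y) = plus_x M R (app M \<mu> X) (app M \<mu> Y)"
proof -
  have "sdiff M \<Omega> \<Omega> = emp M" by (auto intro!: extensionality)
  then show "emp M \<epsilon> \<A>" using space unfolding fin_add_measure_space_def algebra_of_sets_def by metis
qed (use space in \<open>unfold fin_add_measure_space_def algebra_of_sets_def maps_def, blast+\<close>)

lemma m_emp: "emp M \<epsilon> \<B>" "ap m (emp M) = \<zero>"
proof -
  have d: "dfb M True False (\<lambda>e. e (Suc 0) = emp M)"
    by (intro dfb; simp)
  have "\<exists>y. y \<epsilon> powset M Os \<and> y = emp M" by (simp add: subs_def)
  then obtain f where "st M f" "maps M f I (powset M Os)" "\<And>x. x \<epsilon> I \<Longrightarrow> ap f x = emp M"
    using ex_st_function[where P = "\<lambda>x y. y = emp M" and D = I and C = "powset M Os", OF d] by auto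
  then have "w_standard M I w (emp M)" using w_standard_ap w by metis
  note * = m_eq[OF emp_A this]
  have "br (emp M) = emp M"
    by (rule brack_eqI[symmetric]) (simp_all add: subs_def)
  then show "emp M \<epsilon> \<B>" "ap m (emp M) = \<zero>" using * by (simp_all add: mu_emp)
qed

text \<open>Taking unions pointwise in \<open>v\<close> shows that the union of the representing
  sets is \<open>w\<close>-standard and represents \<open>union M A B\<close>. Disjointness passes
  down to these sets: a common element could be chosen \<open>w\<close>-standard, and its germ would
  lie in both \<open>A\<close> and \<open>B\<close>. The rest is additivity of \<open>\<mu>\<close>
  and of the shadow.\<close>

lemma st_m_union:
  assumes "st M A" "st M B" "A \<epsilon> \<B>" "B \<epsilon> \<B>" "disjoint M A B"
  shows "union M A B \<epsilon> \<B> \<and> ap m (union M A B) = plus_x M R (ap m A) (ap m B)"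
proof -
  obtain F where F: "st M F" "maps M F I (powset M Os)" "ap F w \<epsilon> \<A>" "A = br (ap F w)"
    using loeb_algebra_rep assms by blast
  obtain G where G: "st M G" "maps M G I (powset M Os)" "ap G w \<epsilon> \<A>" "B = br (ap G w)"
    using loeb_algebra_rep assms by blast
  let ?X = "ap F w" and ?Y = "ap G w"
  have d: "dfb M True False (\<lambda>e. e (Suc 0) = union M (ap F (e 0)) (ap G (e 0)))"
    using F G by (intro dfb; simp)
  have "\<exists>y. y \<epsilon> powset M Os \<and> y = union M (ap F v) (ap G v)" if "v \<epsilon> I" for v
    using maps_ap(2)[OF F(2) that] maps_ap(2)[OF G(2) that] by (auto simp: subs_def)
  then obtain H where H: "st M H" "maps M H I (powset M Os)" "\<And>v. v \<epsilon> I \<Longrightarrow> ap H v = union M (ap F v) (ap G v)"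
    using ex_st_function[where P = "\<lambda>v y. y = union M (ap F v) (ap G v)" and D = I and C = "powset M Os", OF d]
    by auto
  have wst: "w_standard M I w (union M ?X ?Y)" "w_standard M I w ?X" "w_standard M I w ?Y"
    using w_standard_ap[OF H(1,2)] H(3)[OF w] w_standard_ap[OF F(1,2)] w_standard_ap[OF G(1,2)] by simp_all
  have "subs M A Q" "subs M B Q" using F(4) G(4) brack_subs by simp_all
  then have U: "union M A B = br (union M ?X ?Y)"
    using assms(1,2) by (intro brack_eqI) (auto simp: subs_def F(4) G(4) germ_mem_brack)
  have "disjoint M ?X ?Y" unfolding disjoint_def
  proof
    assume "\<exists>t. t \<epsilon> ?X \<and> t \<epsilon> ?Y"
    then obtain t where t: "t \<epsilon> ?X" "t \<epsilon> ?Y" by blast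
    then have "t \<epsilon> Os" using subs_Os[OF F(3)] by (simp add: subs_def)
    then obtain g where "st M g" "g \<epsilon> FS" "ap g w \<epsilon> ?X" "ap g w \<epsilon> ?Y"
      using ex_w_standard_in_Int[OF F(1) G(1)] t by blast
    then show False using assms(5) germ_mem_brack F(4) G(4) unfolding disjoint_def by blast
  qed
  then show ?thesis
    unfolding U using m_eq[OF union_A[OF F(3) G(3)] wst(1)] m_eq[OF F(3) wst(2)] m_eq[OF G(3) wst(3)] F(3) G(3)
    by (simp add: F(4) G(4) mu_union sh_plus mu_ext)
qed

text \<open>Transfer from standard \<open>A\<close> and \<open>B\<close>; the remaining parameters,
  among them \<open>\<B>\<close> and \<open>m\<close>, are standard.\<close>

lemma m_union:
  assumes "A \<epsilon> \<B>" "B \<epsilon> \<B>" "disjoint M A B"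
  shows "union M A B \<epsilon> \<B>" "ap m (union M A B) = plus_x M R (ap m A) (ap m B)"
proof -
  let ?P = "\<lambda>A B. A \<epsilon> \<B> \<and> B \<epsilon> \<B> \<and> \<not> (\<exists>t. t \<epsilon> A \<and> t \<epsilon> B) \<longrightarrow>
    union M A B \<epsilon> \<B> \<and> ap m (union M A B) = plus_x M R (ap m A) (ap m B)"
  have "?P A B"
  proof (rule transfer_all2[of ?P])
    show "dfb M True False (\<lambda>e. ?P (e 0) (e (Suc 0)))" by (intro dfb; simp)
    show "?P A B" if "st M A" "st M B" for A B
      using st_m_union[OF that] unfolding disjoint_def by blast
  qed
  then show "union M A B \<epsilon> \<B>" "ap m (union M A B) = plus_x M R (ap m A) (ap m B)"
    using assms by (auto simp: disjoint_def)
qed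

end

section \<open>Saturation\<close>

context BST_reals
begin

text \<open>Induction on \<open>n\<close>: an element of the set with index n+1 lies in all earlier
  ones by antitonicity, and if that set is empty, the element found for \<open>n\<close> still
  serves. Thus the last nonempty index is never named.\<close>

lemma ex_element_of_last_nonempty:
  assumes D: "dfb M False False (\<lambda>e. D (e 0) (e (Suc 0)))"
    and antitone: "\<And>n n' t. n \<epsilon> N \<Longrightarrow> n' \<epsilon> N \<Longrightarrow> n \<preceq> n' \<Longrightarrow> D n' t \<Longrightarrow> D n t"
    and C: "\<And>n t. D n t \<Longrightarrow> t \<epsilon> C" "t\<^sub>0 \<epsilon> C" and n: "n \<epsilon> N"
  shows "\<exists>y. y \<epsilon> C \<and> (\<forall>k. k \<epsilon> N \<and> k \<preceq> n \<and> (\<exists>t. D k t) \<longrightarrow> D k y)"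
proof -
  note D' = dfb_subst2[where P = D, OF D]
  let ?P = "\<lambda>n. \<exists>y. y \<epsilon> C \<and> (\<forall>k. k \<epsilon> N \<and> k \<preceq> n \<and> (\<exists>t. D k t) \<longrightarrow> D k y)"
  show "?P n"
  proof (rule nats_induct[where P = ?P, OF n])
    show "dfb M False False (\<lambda>e. ?P (e 0))" by (intro dfb D'; simp)
    have "k = \<zero>" if "k \<epsilon> N" "k \<preceq> \<zero>" for k
      using nats_nonneg[OF that(1)] that(2) less_asym unfolding le_r_def by blast
    \<comment> \<open>If the set with index 0 is empty, \<open>t\<^sub>0\<close> is taken by
      default.\<close>
    then show "?P \<zero>" using C by metis
  next
    fix n assume n: "n \<epsilon> N" and IH: "?P n"
    have k: "k \<preceq> n \<or> k = n \<oplus> \<one>" if "k \<epsilon> N" "k \<preceq> n \<oplus> \<one>" for k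
      using that nats_less_succ_iff[OF n that(1)] unfolding le_r_def[of _ _ _ "n \<oplus> \<one>"] by blast
    show "?P (n \<oplus> \<one>)"
    proof (cases "\<exists>t. D (n \<oplus> \<one>) t")
      case True
      then obtain t where "D (n \<oplus> \<one>) t" ..
      then show ?thesis using antitone[of _ "n \<oplus> \<one>" t] n C(1) succ_nats by blast
    next
      case False
      then show ?thesis using IH k by blast
    qed
  qed
qed

end

context loeb
begin

lemma st_finite_subcover:
  assumes good: "good M R I w"
    and A: "st M A" "A \<epsilon> \<B>" and S: "st M S" "maps M S N \<B>"
    and cover: "\<And>x. x \<epsilon> A \<Longrightarrow> \<exists>k. k \<epsilon> N \<and> x \<epsilon> ap S k"
  shows "\<exists>n. n \<epsilon> N \<and> (\<forall>x. x \<epsilon> A \<longrightarrow> (\<exists>k. k \<epsilon> N \<and> k \<prec> n \<and> x \<epsilon> ap S k))"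
proof -
  obtain F where F: "st M F" "maps M F I (powset M Os)" "A = br (ap F w)"
    using loeb_algebra_rep[OF A] by blast
  let ?C = "funspace M I (powset M Os)"
  let ?P = "\<lambda>k f. ap S k = br (ap f w)"
  have d: "dfb M False True (\<lambda>e. ?P (e 0) (e (Suc 0)))"
    by (intro dfb; simp)
  have "\<exists>f. st M f \<and> f \<epsilon> ?C \<and> ?P k f" if "st M k" "k \<epsilon> N" for k
  proof -
    have "st M (ap S k)" "ap S k \<epsilon> \<B>" using that S maps_ap(2)[OF S(2)] by simp_all
    then show ?thesis using loeb_algebra_rep[of "ap S k"] mem_funspace by metis
  qed
  \<comment> \<open>The relation between \<open>k\<close> and its representing function is external
    because \<open>br\<close> is. Hence \<open>G\<close> is known to represent \<open>S\<close> at
    standard \<open>k\<close> only.\<close>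
  then obtain G where G: "st M G" "maps M G N ?C" "\<And>k. st M k \<Longrightarrow> k \<epsilon> N \<Longrightarrow> ap S k = br (ap (ap G k) w)"
    using ex_st_function_external[where P = ?P and D = N and C = ?C, OF d] by auto
  \<comment> \<open>The remainder of \<open>F v\<close> after removal of the first \<open>n\<close>
    sets. The index \<open>v\<close> is kept variable so that points can be chosen uniformly over
    \<open>I\<close>.\<close>
  let ?D = "\<lambda>v n t. t \<epsilon> ap F v \<and> (\<forall>k. k \<epsilon> N \<and> k \<prec> n \<longrightarrow> \<not> t \<epsilon> ap (ap G k) v)"
  show ?thesis
  proof (cases "\<exists>n. st M n \<and> n \<epsilon> N \<and> \<not> (\<exists>t. ?D w n t)")
    case True
    then obtain n where n: "st M n" "n \<epsilon> N" "\<not> (\<exists>t. ?D w n t)" by blast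
    \<comment> \<open>By transfer only standard \<open>x\<close> matter. These are germs, and the
      indices below the standard \<open>n\<close> are standard, so that \<open>G\<close> may be used
      at them.\<close>
    let ?Q = "\<lambda>x. x \<epsilon> A \<longrightarrow> (\<exists>k. k \<epsilon> N \<and> k \<prec> n \<and> x \<epsilon> ap S k)"
    have "?Q x" for x
    proof (rule transfer_all[of ?Q])
      show "dfb M True False (\<lambda>e. ?Q (e 0))" using A S n by (intro dfb; simp)
      fix x assume "st M x"
      show "?Q x"
      proof
        assume "x \<epsilon> A"
        then obtain f where f: "st M f" "f \<epsilon> FS" "ap f w \<epsilon> ap F w" "x = gm f"
          using brack(2)[OF \<open>st M x\<close>] F(3) by blast
        then obtain k where k: "k \<epsilon> N" "k \<prec> n" "ap f w \<epsilon> ap (ap G k) w" using n(3) by blast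
        then have "st M k" using st_nats_downward n less_imp_le by blast
        then have "x \<epsilon> ap S k" using G(3) k f germ_mem_brack by simp
        then show "\<exists>k. k \<epsilon> N \<and> k \<prec> n \<and> x \<epsilon> ap S k" using k by blast
      qed
    qed
    then show ?thesis using n by blast
  next
    case False
    then have ne: "\<exists>t. ?D w n t" if "st M n" "n \<epsilon> N" for n using that by blast
    \<comment> \<open>Goodness of \<open>w\<close> enters here: the value of \<open>h\<close> at
      \<open>w\<close> is a natural number above all standard ones.\<close>
    obtain h where h: "st M h" "ap h w \<epsilon> N" "\<not> st M (ap h w)"
      using good by (auto simp: good_def w_standard_iff)
    have FOs: "t \<epsilon> Os" if "v \<epsilon> I" "t \<epsilon> ap F v" for v t
      using maps_ap(2)[OF F(2) that(1)] that(2) by (simp add: subs_def)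
    \<comment> \<open>A default point for indices other than \<open>w\<close>: nothing is removed
      for \<open>n = \<zero>\<close>, so \<open>F\<close> has a nonempty value at
      \<open>w\<close>.\<close>
    obtain t\<^sub>0 where t0: "t\<^sub>0 \<epsilon> Os" using ne[of \<zero>] FOs[OF w] by auto
    \<comment> \<open>The guard is there because \<open>ap h v\<close> is known to be a natural
      number only at \<open>v = w\<close>.\<close>
    let ?R = "\<lambda>v y. ap h v \<epsilon> N \<longrightarrow> (\<forall>n. n \<epsilon> N \<and> n \<preceq> ap h v \<and> (\<exists>t. ?D v n t) \<longrightarrow> ?D v n y)"
    have d: "dfb M True False (\<lambda>e. ?R (e 0) (e (Suc 0)))"
      using F G h by (intro dfb; simp)
    have ex: "\<exists>y. y \<epsilon> Os \<and> ?R v y" if v: "v \<epsilon> I" for v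
    proof (cases "ap h v \<epsilon> N")
      case True
      have "\<exists>y. y \<epsilon> Os \<and> (\<forall>n. n \<epsilon> N \<and> n \<preceq> ap h v \<and> (\<exists>t. ?D v n t) \<longrightarrow> ?D v n y)"
      proof (rule ex_element_of_last_nonempty[where D = "?D v", OF _ _ _ t0 True])
        show "dfb M False False (\<lambda>e. ?D v (e 0) (e (Suc 0)))" by (intro dfb; simp)
        show "?D v n t" if "n \<preceq> n'" "?D v n' t" for n n' t
          using that less_le_trans by blast
        show "t \<epsilon> Os" if "?D v n t" for n t using that FOs v by blast
      qed
      then show ?thesis by blast
    next
      case False
      then show ?thesis using t0 by blast
    qed
    obtain g where g: "st M g" "maps M g I Os" "\<And>v. v \<epsilon> I \<Longrightarrow> ?R v (ap g v)"
    proof (rule ex_st_function[where P = ?R and D = I and C = Os, OF d st_I st_Os ex])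
      fix f assume "st M f" "maps M f I Os" "\<And>v. v \<epsilon> I \<Longrightarrow> ?R v (ap f v)"
      then show thesis by (rule that)
    qed
    \<comment> \<open>A standard \<open>n\<close> lies below the value of \<open>h\<close> at
      \<open>w\<close> and has a nonempty remainder, so the choice of \<open>g\<close> applies to
      it.\<close>
    have gD: "?D w n (ap g w)" if n: "st M n" "n \<epsilon> N" for n
    proof -
      have "\<not> ap h w \<prec> n" using st_nats_downward[OF n h(2)] h(3) less_imp_le by blast
      then have "n \<preceq> ap h w" using not_less h n by simp
      then show ?thesis using g(3)[OF w] h(2) n ne[OF n] by blast
    qed
    have gFS: "g \<epsilon> FS" using g by simp
    have "gm g \<epsilon> A" using gD[of \<zero>] germ_mem_brack[OF g(1) gFS] F(3) by simp
    moreover have "dfb M True False (\<lambda>e. e 0 \<epsilon> N \<and> gm g \<epsilon> ap S (e 0))"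
      using S germ(1)[OF gFS] by (intro dfb; simp)
    \<comment> \<open>The germ of \<open>g\<close> is standard, so transfer provides a standard
      index of a set that covers it, where \<open>G\<close> does represent \<open>S\<close>.\<close>
    ultimately obtain k where k: "st M k" "k \<epsilon> N" "gm g \<epsilon> ap S k"
      using transfer_ex[of "\<lambda>k. k \<epsilon> N \<and> gm g \<epsilon> ap S k"] cover by blast
    then have "ap g w \<epsilon> ap (ap G k) w" using G(3) germ_mem_brack[OF g(1) gFS] by simp
    \<comment> \<open>The remainder omits only indices strictly below \<open>n\<close>, so excluding
      \<open>k\<close> takes n = k+1.\<close>
    moreover have "k \<prec> k \<oplus> \<one>" using less_succ k by simp
    ultimately have False using gD[of "k \<oplus> \<one>"] k by simp
    then show ?thesis ..
  qed
qed

text \<open>Transfer from standard \<open>A\<close> and \<open>S\<close>. Goodness remains outside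
  the transferred statement because it mentions \<open>st\<close>.\<close>

lemma finite_subcover:
  assumes "good M R I w" "A \<epsilon> \<B>" "maps M S N \<B>"
    and "\<And>x. x \<epsilon> A \<Longrightarrow> \<exists>k. k \<epsilon> N \<and> x \<epsilon> ap S k"
  shows "\<exists>n. n \<epsilon> N \<and> (\<forall>x. x \<epsilon> A \<longrightarrow> (\<exists>k. k \<epsilon> N \<and> k \<prec> n \<and> x \<epsilon> ap S k))"
proof -
  let ?P = "\<lambda>A S. A \<epsilon> \<B> \<and> maps M S N \<B> \<and> (\<forall>x. x \<epsilon> A \<longrightarrow> (\<exists>k. k \<epsilon> N \<and> x \<epsilon> ap S k)) \<longrightarrow>
    (\<exists>n. n \<epsilon> N \<and> (\<forall>x. x \<epsilon> A \<longrightarrow> (\<exists>k. k \<epsilon> N \<and> k \<prec> n \<and> x \<epsilon> ap S k)))"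
  have "?P A S"
  proof (rule transfer_all2[of ?P])
    show "dfb M True False (\<lambda>e. ?P (e 0) (e (Suc 0)))"
      unfolding maps_iff using loeb_algebra(1) by (intro dfb; simp)
    show "?P A S" if "st M A" "st M S" for A S
      using st_finite_subcover[OF assms(1) that(1) _ that(2)] by blast
  qed
  then show ?thesis using assms by blast
qed

end

section \<open>Countable additivity\<close>

context loeb_measure
begin

text \<open>A relation rather than a set-valued operation, so that it is definable before the unions
  are known to exist in \<open>\<B>\<close>. The strict bound matches partial sums that start with
  0.\<close>

definition is_partial_union :: "'a \<Rightarrow> 'a \<Rightarrow> 'a \<Rightarrow> bool" where
  "is_partial_union S n U \<longleftrightarrow> (\<forall>t. t \<epsilon> U \<longleftrightarrow> (\<exists>k. k \<epsilon> N \<and> k \<prec> n \<and> t \<epsilon> ap S k))"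

lemma dfb_is_partial_union [dfb]:
  "deft M False b t \<Longrightarrow> deft M False b u \<Longrightarrow> dfb M False b (\<lambda>e. is_partial_union S (t e) (u e))"
  by (rule dfb_subst2[where P = "\<lambda>n U. is_partial_union S n U"])
    (unfold is_partial_union_def, intro dfb; simp)

lemma is_partial_union_unique: "is_partial_union S n U \<Longrightarrow> is_partial_union S n V \<Longrightarrow> U = V"
  unfolding is_partial_union_def by (rule extensionality) blast

lemma is_partial_union_0: "is_partial_union S \<zero> (emp M)"
proof -
  have "\<not> k \<prec> \<zero>" if "k \<epsilon> N" for k
    using less_le_trans[OF _ nats_nonneg[OF that], of k] less_irrefl[of k] that by auto
  then show ?thesis by (auto simp: is_partial_union_def)
qed

lemma is_partial_union_succ:
  assumes "n \<epsilon> N" "is_partial_union S n U"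
  shows "is_partial_union S (n \<oplus> \<one>) (union M U (ap S n))"
proof -
  have "k \<prec> n \<oplus> \<one> \<longleftrightarrow> k \<prec> n \<or> k = n" if "k \<epsilon> N" for k
    using nats_less_succ_iff[OF assms(1) that] by (simp add: le_r_def)
  then show ?thesis using assms unfolding is_partial_union_def mem_union by blast
qed

text \<open>The partial sums are the measures of the partial unions. By
  \<open>finite_subcover\<close> these unions equal \<open>A\<close> from some index on, so the
  partial sums become constant.\<close>

lemma m_sums:
  assumes good: "good M R I w" and S: "maps M S N \<B>"
    and disj: "\<And>j k. j \<epsilon> N \<Longrightarrow> k \<epsilon> N \<Longrightarrow> j \<noteq> k \<Longrightarrow> disjoint M (ap S j) (ap S k)"
    and A: "A \<epsilon> \<B>" "\<And>x. x \<epsilon> A \<longleftrightarrow> (\<exists>k. k \<epsilon> N \<and> x \<epsilon> ap S k)"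
    and a: "\<And>k. k \<epsilon> N \<Longrightarrow> a k = ap m (ap S k)"
  shows "sums_x M R a (ap m A)"
proof -
  have disjoint: "disjoint M U (ap S n)" if "n \<epsilon> N" "is_partial_union S n U" for n U
  proof -
    have "disjoint M (ap S k) (ap S n)" if "k \<epsilon> N" "k \<prec> n" for k
      using disj[OF that(1) \<open>n \<epsilon> N\<close>] less_irrefl[OF nats_real[OF \<open>n \<epsilon> N\<close>]] that(2) by blast
    then show ?thesis using that(2) unfolding is_partial_union_def disjoint_def by blast
  qed
  \<comment> \<open>The induction is internal and reaches nonstandard \<open>n\<close> too; this is
    why \<open>m_union\<close> is used beyond standard sets.\<close>
  have ex: "\<exists>U. U \<epsilon> \<B> \<and> is_partial_union S n U" if "n \<epsilon> N" for n
  proof (rule nats_induct[OF that, of "\<lambda>n. \<exists>U. U \<epsilon> \<B> \<and> is_partial_union S n U"])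
    show "dfb M False False (\<lambda>e. \<exists>U. U \<epsilon> \<B> \<and> is_partial_union S (e 0) U)"
      by (intro dfb; simp)
    show "\<exists>U. U \<epsilon> \<B> \<and> is_partial_union S \<zero> U"
      using m_emp(1) is_partial_union_0 by blast
    show "\<exists>U. U \<epsilon> \<B> \<and> is_partial_union S (n \<oplus> \<one>) U"
      if "n \<epsilon> N" "\<exists>U. U \<epsilon> \<B> \<and> is_partial_union S n U" for n
      using that is_partial_union_succ m_union(1) disjoint maps_ap(2)[OF S] by blast
  qed
  let ?P = "\<lambda>n y. \<exists>U. U \<epsilon> \<B> \<and> is_partial_union S n U \<and> y = ap m U"
  have "\<exists>p. maps M p N (ext_nonneg M R) \<and> (\<forall>n. n \<epsilon> N \<longrightarrow> ?P n (ap p n))"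
  proof (rule ex_function[where P = ?P])
    show "dfb M False False (\<lambda>e. ?P (e 0) (e (Suc 0)))" by (intro dfb; simp)
    show "\<exists>y. y \<epsilon> ext_nonneg M R \<and> ?P n y" if "n \<epsilon> N" for n
      using ex[OF that] maps_ap(2)[OF m_maps] by blast
  qed
  then obtain p where p: "maps M p N (ext_nonneg M R)" "\<And>n. n \<epsilon> N \<Longrightarrow> ?P n (ap p n)" by blast
  have p_eq: "app M p n = ap m U" if "n \<epsilon> N" "is_partial_union S n U" for n U
    using p(2)[OF that(1)] that(2) maps_ap(1)[OF p(1) that(1)] is_partial_union_unique by metis
  have "app M p \<zero> = \<zero>"
    using p_eq is_partial_union_0 m_emp(2) zero_nats by metis
  moreover have "app M p (k \<oplus> \<one>) = plus_x M R (app M p k) (a k)" if k: "k \<epsilon> N" for k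
  proof -
    obtain U where U: "U \<epsilon> \<B>" "is_partial_union S k U" using ex k by blast
    show ?thesis
      using p_eq[OF k U(2)] p_eq[OF succ_nats[OF k] is_partial_union_succ[OF k U(2)]]
        m_union(2)[OF U(1) maps_ap(2)[OF S k] disjoint[OF k U(2)]] a[OF k] by simp
  qed
  moreover have "tends_x M R p (ap m A)"
  proof -
    obtain n where n: "n \<epsilon> N" "\<And>x. x \<epsilon> A \<Longrightarrow> \<exists>k. k \<epsilon> N \<and> k \<prec> n \<and> x \<epsilon> ap S k"
      using finite_subcover[OF good A(1) S] A(2) by blast
    \<comment> \<open>One inclusion is the choice of \<open>n\<close>, the other holds because each
      set of the sequence lies in \<open>A\<close>.\<close>
    have "is_partial_union S k A" if "n \<preceq> k" for k
      unfolding is_partial_union_def using n(2) A(2) less_le_trans[OF _ that] by blast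
    then show ?thesis
      using p_eq n(1) maps_ap(2)[OF m_maps A(1)] by (intro tends_x_eventually_const[of _ n]) blast+
  qed
  ultimately show ?thesis unfolding sums_x_def using p(1) by blast
qed

end

theorem lemma4p9:
  fixes M :: "'u set_structure" (structure)
    and R :: "'u real_structure"
    and \<Omega> \<A> \<mu> Os I w m Aseq A :: 'u
  assumes "BST_model M"
    and "standard_reals M R"
    and "fin_add_measure_space M R \<Omega> \<A> \<mu>"
    and "st M Os" and "subs M \<Omega> Os"
    and "st M I" and "w \<epsilon> I" and "good M R I w"
    and "w_standard M I w \<Omega>" and "w_standard M I w \<A>" and "w_standard M I w \<mu>"
    and "is_loeb_measure M R I Os w \<A> \<mu> m"
    and "maps M Aseq (nats M R) (loeb_algebra M I Os w \<A>)"
    and "\<forall>j k. j \<epsilon> nats M R \<and> k \<epsilon> nats M R \<and> j \<noteq> k \<longrightarrow> disjoint M (app M Aseq j) (app M Aseq k)"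
    and "A \<epsilon> loeb_algebra M I Os w \<A>"
    and "\<forall>x. x \<epsilon> A \<longleftrightarrow> (\<exists>k. k \<epsilon> nats M R \<and> x \<epsilon> app M Aseq k)"
  shows "sums_x M R (\<lambda>k. app M m (app M Aseq k)) (app M m A)"
proof -
  interpret BST_model M by fact
  interpret loeb_measure M R Os I w \<A> \<Omega> \<mu> m
  proof unfold_locales
    fix X assume "X \<epsilon> \<A>"
    then show "subs M X Os"
      using assms(3,5) unfolding fin_add_measure_space_def algebra_of_sets_def subs_def by blast
  qed (use assms in blast)+
  \<comment> \<open>The development works with the total \<open>ap\<close>, which agrees with
    \<open>app\<close> on the domain.\<close>
  have S: "app M Aseq k = ap Aseq k" if "k \<epsilon> N" for k
    using maps_ap(1)[OF assms(13) that] .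
  have "sums_x M R (\<lambda>k. app M m (app M Aseq k)) (ap m A)"
  proof (rule m_sums[OF assms(8,13) _ assms(15)])
    show "disjoint M (ap Aseq j) (ap Aseq k)" if "j \<epsilon> N" "k \<epsilon> N" "j \<noteq> k" for j k
      using assms(14) that S by metis
    show "x \<epsilon> A \<longleftrightarrow> (\<exists>k. k \<epsilon> N \<and> x \<epsilon> ap Aseq k)" for x
      using assms(16) S by metis
    show "app M m (app M Aseq k) = ap m (ap Aseq k)" if "k \<epsilon> N" for k
      using S[OF that] maps_ap(1)[OF m_maps maps_ap(2)[OF assms(13) that]] by simp
  qed
  then show ?thesis using maps_ap(1)[OF m_maps assms(15)] by simp
qed

end
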